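(* Let $F=\prod_{i\in I}\mathbb{F}_{q_i}/\mathcal{U}$ be a pseudofinite field and $A=\prod_{i\in I}A_i/\mathcal{U}$ an infinite internal subset of $F$. Suppose there is a positive constant $C$ such that $\{i\in I:|A_i|\le C\log_2 q_i\}\in\mathcal{U}$. Then all internal subsets of $A$ are uniformly definable: there is a formula $\theta(x,\bar y)$ in the language of rings expanded by a unary predicate interpreted as $A$ such that for every internal subset $E\subseteq A$ there is a tuple $\bar c$ from $F$ with $E=\{a\in F:(F,A)\models\theta(a,\bar c)\}$.
   Context: $\mathcal{U}$ is a non-principal ultrafilter on $I$, each $\mathbb{F}_{q_i}$ a finite field, $A_i\subseteq\mathbb{F}_{q_i}$. A subset of $F$ is internal if it is of the form $\prod_{i\in I}E_i/\mathcal{U}$ with $E_i\subseteq\mathbb{F}_{q_i}$. *)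

theory Defs
  imports "HOL-Algebra.Ring" "HOL-Algebra.Ring_Divisibility" Complex_Main
begin

definition ultrafilter :: "'i filter \<Rightarrow> bool" where
  "ultrafilter U \<longleftrightarrow> U \<noteq> bot \<and> (\<forall>P. eventually P U \<or> eventually (\<lambda>i. \<not> P i) U)"

definition nonprincipal :: "'i filter \<Rightarrow> bool" where
  "nonprincipal U \<longleftrightarrow> (\<forall>j. \<not> eventually (\<lambda>i. i = j) U)"

definition uprep :: "('i \<Rightarrow> ('a, 'b) ring_scheme) \<Rightarrow> ('i \<Rightarrow> 'a) set" where
  "uprep K = {f. \<forall>i. f i \<in> carrier (K i)}"

definition uclass :: "'i filter \<Rightarrow> ('i \<Rightarrow> ('a, 'b) ring_scheme) \<Rightarrow> ('i \<Rightarrow> 'a) \<Rightarrow> ('i \<Rightarrow> 'a) set" where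
  "uclass U K f = {g \<in> uprep K. eventually (\<lambda>i. f i = g i) U}"

definition ucarrier :: "'i filter \<Rightarrow> ('i \<Rightarrow> ('a, 'b) ring_scheme) \<Rightarrow> ('i \<Rightarrow> 'a) set set" where
  "ucarrier U K = uclass U K ` uprep K"

definition urep :: "'i filter \<Rightarrow> ('i \<Rightarrow> ('a, 'b) ring_scheme) \<Rightarrow> ('i \<Rightarrow> 'a) set \<Rightarrow> 'i \<Rightarrow> 'a" where
  "urep U K x = (SOME f. f \<in> uprep K \<and> uclass U K f = x)"

definition uzero where "uzero U K = uclass U K (\<lambda>i. \<zero>\<^bsub>K i\<^esub>)"
definition uone where "uone U K = uclass U K (\<lambda>i. \<one>\<^bsub>K i\<^esub>)"
definition uadd where
  "uadd U K x y = uclass U K (\<lambda>i. urep U K x i \<oplus>\<^bsub>K i\<^esub> urep U K y i)"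
definition umul where
  "umul U K x y = uclass U K (\<lambda>i. urep U K x i \<otimes>\<^bsub>K i\<^esub> urep U K y i)"
definition uneg where
  "uneg U K x = uclass U K (\<lambda>i. \<ominus>\<^bsub>K i\<^esub> urep U K x i)"

definition uset :: "'i filter \<Rightarrow> ('i \<Rightarrow> ('a, 'b) ring_scheme) \<Rightarrow> ('i \<Rightarrow> 'a set) \<Rightarrow> ('i \<Rightarrow> 'a) set set" where
  "uset U K E = {uclass U K f | f. f \<in> uprep K \<and> eventually (\<lambda>i. f i \<in> E i) U}"

definition internal :: "'i filter \<Rightarrow> ('i \<Rightarrow> ('a, 'b) ring_scheme) \<Rightarrow> ('i \<Rightarrow> 'a) set set \<Rightarrow> bool" where
  "internal U K S \<longleftrightarrow> (\<exists>E. (\<forall>i. E i \<subseteq> carrier (K i)) \<and> S = uset U K E)"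

datatype rtm = Var nat | Zero | One | Add rtm rtm | Mul rtm rtm | Neg rtm

datatype rfm = Eq rtm rtm | Pred rtm | Not rfm | Conj rfm rfm | Ex nat rfm

fun ueval :: "'i filter \<Rightarrow> ('i \<Rightarrow> ('a, 'b) ring_scheme) \<Rightarrow> (nat \<Rightarrow> ('i \<Rightarrow> 'a) set) \<Rightarrow> rtm \<Rightarrow> ('i \<Rightarrow> 'a) set" where
  "ueval U K \<rho> (Var n) = \<rho> n"
| "ueval U K \<rho> Zero = uzero U K"
| "ueval U K \<rho> One = uone U K"
| "ueval U K \<rho> (Add s t) = uadd U K (ueval U K \<rho> s) (ueval U K \<rho> t)"
| "ueval U K \<rho> (Mul s t) = umul U K (ueval U K \<rho> s) (ueval U K \<rho> t)"
| "ueval U K \<rho> (Neg s) = uneg U K (ueval U K \<rho> s)"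

fun usat :: "'i filter \<Rightarrow> ('i \<Rightarrow> ('a, 'b) ring_scheme) \<Rightarrow> ('i \<Rightarrow> 'a) set set \<Rightarrow> (nat \<Rightarrow> ('i \<Rightarrow> 'a) set) \<Rightarrow> rfm \<Rightarrow> bool" where
  "usat U K P \<rho> (Eq s t) = (ueval U K \<rho> s = ueval U K \<rho> t)"
| "usat U K P \<rho> (Pred t) = (ueval U K \<rho> t \<in> P)"
| "usat U K P \<rho> (Not \<phi>) = (\<not> usat U K P \<rho> \<phi>)"
| "usat U K P \<rho> (Conj \<phi> \<psi>) = (usat U K P \<rho> \<phi> \<and> usat U K P \<rho> \<psi>)"
| "usat U K P \<rho> (Ex n \<phi>) = (\<exists>a \<in> ucarrier U K. usat U K P (\<rho>(n := a)) \<phi>)"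

end

(* A subset of A_i is coded by a bounded number of parameters through the solvability of one
   equation in one unknown. In odd characteristic the equation is t^2 = (z_1 - x) ... (z_m - x);
   in characteristic two it is t^2 + t = c_1 / (z_1 - x) + ... + c_m / (z_m - x). By Fourier
   analysis on the sign vectors indexed by A_i, every subset is coded once the character sums
   attached to the nonempty subsets S of A_i are small enough. In characteristic two a union bound
   over S provides poles z_j for which all of these sums vanish. In odd characteristic they are the
   m-th powers of the sums over z of the quadratic character of the product of z - x for x in S, and
   Stepanov's method saves a power of q in each of them, which beats the 2^|A_i| <= q^C subsets once
   m is large compared with C. The theorem of Los transfers the coding to the ultraproduct. *)

theory Submission
  imports Defs "HOL-Algebra.Weak_Morphisms" "HOL-Library.Z2" "HOL-Library.Cardinality"
    "HOL-Real_Asymp.Real_Asymp" "HOL-Number_Theory.Cong" "HOL-Computational_Algebra.Polynomial"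
begin

text \<open>Coding needs a sign on the field that a formula can express. In odd characteristic the
  nonzero squares have index two in the multiplicative group; in characteristic two every element is
  a square, and the image of t^2 + t, of index two in the additive group, replaces them. The
  additive sign is linear in the coefficients c_j, so orthogonality gives exact cancellation. The
  multiplicative sign has no such coefficients, and cancellation must come from a bound on character
  sums whose degree |S| may grow like log q.

  Any fixed power saving will do, since m amplifies it, which leaves room for a crude form of
  Stepanov's method. With q = 2M + 1 and f the product of X - x over S, it seeks R as a sum of (r_j
  + s_j f^M) X^(jq). Near a point z with f(z)^M = a, both X^q and f^M simplify, so a high order of
  vanishing costs few conditions on r_j and s_j; yet R is nonzero because f has simple roots. A
  pigeonhole argument stands in for linear algebra, and expansion at translated points for
  derivatives, which lose multiplicities in positive characteristic.\<close>

section \<open>Polynomials over finite fields\<close>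

lemma finite_field_fermat:
  fixes x :: "'a::{field,finite}"
  assumes "x \<noteq> 0"
  shows "x ^ (CARD('a) - 1) = 1"
proof -
  let ?P = "\<Prod>y\<in>UNIV-{0::'a}. y"
  have bij: "bij_betw (\<lambda>y. x * y) (UNIV - {0}) (UNIV - {0})"
    by (rule bij_betwI[where g = "\<lambda>y. y / x"]) (use assms in auto)
  have "?P = (\<Prod>y\<in>UNIV-{0}. x * y)"
    by (rule prod.reindex_bij_betw[OF bij, symmetric])
  also have "\<dots> = x ^ (CARD('a) - 1) * ?P"
    by (simp add: prod.distrib card_Diff_singleton)
  finally have "?P * 1 = ?P * x ^ (CARD('a) - 1)"
    by (simp add: mult.commute)
  moreover have "?P \<noteq> 0" by simp
  ultimately show ?thesis
    by (metis mult_left_cancel)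
qed

lemma finite_field_power_card:
  fixes x :: "'a::{field,finite}"
  shows "x ^ CARD('a) = x"
proof (cases "x = 0")
  case False
  have "x ^ CARD('a) = x * x ^ (CARD('a) - 1)"
    by (metis finite_UNIV_card_ge_0 finite_class.finite_UNIV power_minus_mult mult.commute)
  then show ?thesis
    using finite_field_fermat[OF False] by simp
qed (simp add: finite_UNIV_card_ge_0)

text \<open>Both sides agree at every field element and have the same leading coefficient, so no
  binomial coefficient has to be computed.\<close>

lemma linear_poly_power_card:
  fixes x :: "'a::{field,finite}"
  shows "[:x, 1:] ^ CARD('a) = monom 1 CARD('a) + [:x:]"
proof (rule poly_eqI_degree_lead_coeff[where n = "CARD('a)" and A = UNIV])
  have "lead_coeff ([:x, 1:] ^ CARD('a)) = 1"
    by (simp add: lead_coeff_power)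
  then show "coeff ([:x, 1:] ^ CARD('a)) CARD('a) = coeff (monom 1 CARD('a) + [:x:]) CARD('a)"
    by (simp add: degree_linear_power coeff_pCons split: nat.splits)
  show "degree (monom 1 CARD('a) + [:x:]) \<le> CARD('a)"
    by (rule degree_add_le) (auto simp: degree_monom_eq)
  show "poly ([:x, 1:] ^ CARD('a)) z = poly (monom 1 CARD('a) + [:x:]) z" for z
    by (simp add: poly_monom finite_field_power_card)
qed (simp_all add: degree_linear_power)

section \<open>Counting polynomials of bounded degree\<close>

text \<open>Stated by coefficients because \<open>degree 0 = 0\<close>: the condition
  \<open>degree p < d\<close> would lose the zero polynomial at d = 0 and with it the exact count
  q^d.\<close>

definition polys_below :: "nat \<Rightarrow> 'a::zero poly set" where
  "polys_below d = {p. \<forall>i\<ge>d. coeff p i = 0}"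

lemma polys_below_iff: "p \<in> polys_below d \<longleftrightarrow> p = 0 \<or> degree p < d"
proof -
  have "p \<in> polys_below d \<Longrightarrow> p \<noteq> 0 \<Longrightarrow> degree p < d"
    by (metis (mono_tags, lifting) leading_coeff_0_iff mem_Collect_eq not_le polys_below_def)
  then show ?thesis
    by (auto simp: polys_below_def coeff_eq_0)
qed

lemma polys_below_diff:
  fixes p :: "'a::ab_group_add poly"
  shows "p \<in> polys_below d \<Longrightarrow> p' \<in> polys_below d \<Longrightarrow> p - p' \<in> polys_below d"
  by (simp add: polys_below_def)

lemma bij_betw_polys_below:
  "bij_betw (\<lambda>p. restrict (coeff p) {..<d}) (polys_below d) ({..<d} \<rightarrow>\<^sub>E (UNIV :: 'a::zero set))"
proof (rule bij_betwI')
  fix p p' :: "'a poly" assume p: "p \<in> polys_below d" "p' \<in> polys_below d"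
  show "(restrict (coeff p) {..<d} = restrict (coeff p') {..<d}) = (p = p')"
  proof
    assume eq: "restrict (coeff p) {..<d} = restrict (coeff p') {..<d}"
    show "p = p'"
    proof (rule poly_eqI)
      fix i show "coeff p i = coeff p' i"
        using fun_cong[OF eq, of i] p by (cases "i < d") (auto simp: polys_below_def)
    qed
  qed simp
next
  fix h :: "nat \<Rightarrow> 'a" assume h: "h \<in> {..<d} \<rightarrow>\<^sub>E UNIV"
  define p where "p = Abs_poly (\<lambda>i. if i < d then h i else 0)"
  have "coeff p = (\<lambda>i. if i < d then h i else 0)"
    unfolding p_def by (rule coeff_Abs_poly[of d]) auto
  then have "p \<in> polys_below d" "h i = restrict (coeff p) {..<d} i" for i
    using h by (simp_all add: polys_below_def PiE_def extensional_def)
  then show "\<exists>p\<in>polys_below d. h = restrict (coeff p) {..<d}"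
    by blast
qed simp

lemma card_polys_below: "card (polys_below d :: 'a::{zero,finite} poly set) = CARD('a) ^ d"
  using bij_betw_same_card[OF bij_betw_polys_below[of d]] by (simp add: card_PiE)

lemma finite_polys_below: "finite (polys_below d :: 'a::{zero,finite} poly set)"
  using bij_betw_finite[OF bij_betw_polys_below[of d, where 'a='a]] by (simp add: finite_PiE)

section \<open>Polynomial functions, and polynomials whose coefficients are polynomial
  functions\<close>

text \<open>Functions rather than polynomials: the pigeonhole argument works with values at field
  elements and needs only an upper bound on the number of possible functions.\<close>

definition polyfuns :: "nat \<Rightarrow> ('a::comm_ring_1 \<Rightarrow> 'a) set" where
  "polyfuns d = {h. \<exists>p. degree p \<le> d \<and> h = poly p}"

lemma polyfuns_mono: "h \<in> polyfuns d \<Longrightarrow> d \<le> e \<Longrightarrow> h \<in> polyfuns e"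
  unfolding polyfuns_def by force

lemma polyfuns_const: "(\<lambda>_. c) \<in> polyfuns d"
  unfolding polyfuns_def by (auto intro!: exI[of _ "[:c:]"])

lemma polyfuns_poly: "degree p \<le> d \<Longrightarrow> poly p \<in> polyfuns d"
  unfolding polyfuns_def by blast

lemma polyfuns_add:
  assumes "h \<in> polyfuns d" "k \<in> polyfuns d"
  shows "(\<lambda>z. h z + k z) \<in> polyfuns d"
proof -
  obtain p r where "degree p \<le> d" "h = poly p" "degree r \<le> d" "k = poly r"
    using assms unfolding polyfuns_def by blast
  then show ?thesis
    unfolding polyfuns_def by (auto intro!: exI[of _ "p + r"] degree_add_le)
qed

lemma polyfuns_mult:
  assumes "h \<in> polyfuns d" "k \<in> polyfuns e"
  shows "(\<lambda>z. h z * k z) \<in> polyfuns (d + e)"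
proof -
  obtain p r where "degree p \<le> d" "h = poly p" "degree r \<le> e" "k = poly r"
    using assms unfolding polyfuns_def by blast
  then show ?thesis
    unfolding polyfuns_def
    by (auto intro!: exI[of _ "p * r"] order.trans[OF degree_mult_le] add_mono)
qed

lemma polyfuns_sum:
  "(\<And>i. i \<in> I \<Longrightarrow> h i \<in> polyfuns d) \<Longrightarrow> (\<lambda>z. \<Sum>i\<in>I. h i z) \<in> polyfuns d"
  by (induction I rule: infinite_finite_induct) (auto intro: polyfuns_add polyfuns_const)

lemma polyfuns_subset_image: "polyfuns d \<subseteq> poly ` polys_below (Suc d)"
  unfolding polyfuns_def by (auto simp: polys_below_iff less_Suc_eq_le intro!: imageI)

lemma card_polyfuns_le: "card (polyfuns d :: ('a::{comm_ring_1,finite} \<Rightarrow> 'a) set) \<le> CARD('a) ^ Suc d"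
  using surj_card_le[OF finite_polys_below polyfuns_subset_image]
  by (metis card_polys_below)

text \<open>Stands for polynomials in two variables whose degree in the parameter z is at most d.
  The degree in the other variable is left free, since later only the coefficients below X^l are
  inspected.\<close>

definition polyfams :: "nat \<Rightarrow> ('a::comm_ring_1 \<Rightarrow> 'a poly) set" where
  "polyfams d = {H. \<forall>i. (\<lambda>z. coeff (H z) i) \<in> polyfuns d}"

lemma polyfams_mono: "H \<in> polyfams d \<Longrightarrow> d \<le> e \<Longrightarrow> H \<in> polyfams e"
  unfolding polyfams_def by (auto intro: polyfuns_mono)

lemma polyfams_const: "(\<lambda>_. p) \<in> polyfams d"
  unfolding polyfams_def by (simp add: polyfuns_const)

lemma polyfams_add: "H \<in> polyfams d \<Longrightarrow> K \<in> polyfams d \<Longrightarrow> (\<lambda>z. H z + K z) \<in> polyfams d"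
  unfolding polyfams_def by (simp add: polyfuns_add)

lemma polyfams_sum:
  "(\<And>i. i \<in> I \<Longrightarrow> H i \<in> polyfams d) \<Longrightarrow> (\<lambda>z. \<Sum>i\<in>I. H i z) \<in> polyfams d"
  by (induction I rule: infinite_finite_induct) (auto intro: polyfams_add polyfams_const)

lemma polyfams_mult:
  "H \<in> polyfams d \<Longrightarrow> K \<in> polyfams e \<Longrightarrow> (\<lambda>z. H z * K z) \<in> polyfams (d + e)"
  unfolding polyfams_def by (auto simp: coeff_mult intro!: polyfuns_sum polyfuns_mult)

lemma polyfams_smult:
  "h \<in> polyfuns d \<Longrightarrow> H \<in> polyfams e \<Longrightarrow> (\<lambda>z. smult (h z) (H z)) \<in> polyfams (d + e)"
  unfolding polyfams_def by (auto intro!: polyfuns_mult)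

lemma polyfams_power: "H \<in> polyfams d \<Longrightarrow> (\<lambda>z. H z ^ n) \<in> polyfams (n * d)"
  by (induction n) (auto simp: polyfams_const intro: polyfams_mult)

lemma polyfuns_power: "h \<in> polyfuns d \<Longrightarrow> (\<lambda>z. h z ^ n) \<in> polyfuns (n * d)"
  by (induction n) (auto simp: polyfuns_const intro: polyfuns_mult)

lemma polyfams_const_poly:
  assumes "h \<in> polyfuns d"
  shows "(\<lambda>z. [:h z:]) \<in> polyfams d"
  unfolding polyfams_def
proof (intro CollectI allI)
  show "(\<lambda>z. coeff [:h z:] i) \<in> polyfuns d" for i
    using assms by (cases i) (simp_all add: polyfuns_const)
qed

text \<open>The coefficients of p(z + X) are the Hasse derivatives of p at z. Horner's scheme
  multiplies by z + X once per degree of p, each time raising the degree in z by one.\<close>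

lemma polyfams_translate:
  fixes p :: "'a::comm_ring_1 poly"
  shows "(\<lambda>z. pcompose p [:z, 1:]) \<in> polyfams (degree p)"
proof (induction p)
  case 0
  then show ?case by (simp add: polyfams_const)
next
  case (pCons a p)
  show ?case
  \<comment> \<open>A constant is treated apart, since \<open>degree (pCons a 0)\<close> is 0 and
    not \<open>1 + degree 0\<close>.\<close>
  proof (cases "p = 0")
    case True
    then show ?thesis by (simp add: pcompose_pCons polyfams_const)
  next
    case False
    have lin: "(\<lambda>z::'a. [:z, 1:]) \<in> polyfams 1"
      unfolding polyfams_def
    proof (intro CollectI allI)
      fix i
      have "(\<lambda>z::'a. z) \<in> polyfuns 1"
        unfolding polyfuns_def by (auto simp: fun_eq_iff intro!: exI[of _ "[:0, 1:]"])
      then show "(\<lambda>z::'a. coeff [:z, 1:] i) \<in> polyfuns 1"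
        by (cases i) (simp_all add: polyfuns_const)
    qed
    have "(\<lambda>z. [:a:] + [:z, 1:] * pcompose p [:z, 1:]) \<in> polyfams (1 + degree p)"
      by (rule polyfams_add[OF polyfams_const polyfams_mult[OF lin pCons.IH]])
    then show ?thesis
      using False by (simp only: pcompose_pCons degree_pCons_eq) simp
  qed
qed

section \<open>Stepanov's method for a product of linear factors\<close>

definition root_poly :: "'a::comm_ring_1 set \<Rightarrow> 'a poly" where
  "root_poly S = (\<Prod>x\<in>S. [:- x, 1:])"

lemma poly_root_poly: "poly (root_poly S) z = (\<Prod>x\<in>S. z - x)"
  by (simp add: root_poly_def poly_prod)

lemma degree_root_poly: "degree (root_poly S :: 'a::field poly) = card S"
  by (simp add: root_poly_def degree_prod_sum_eq)

lemma root_poly_nonzero: "root_poly S \<noteq> (0 :: 'a::field poly)"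
  unfolding root_poly_def by (cases "finite S") (auto simp: prod_zero_iff)

lemma order_root_poly:
  fixes x :: "'a::field"
  assumes "finite S" "x \<in> S"
  shows "Polynomial.order x (root_poly S) = 1"
proof -
  have eq: "root_poly S = [:- x, 1:] * root_poly (S - {x})"
    unfolding root_poly_def using assms by (simp add: prod.remove)
  have "poly (root_poly (S - {x})) x \<noteq> 0"
    using assms by (auto simp: poly_root_poly)
  then have "Polynomial.order x (root_poly (S - {x})) = 0"
    by (rule order_0I)
  moreover have "Polynomial.order x [:- x, 1:] = 1"
    using order_power_n_n[of x 1] by simp
  moreover have "Polynomial.order x (root_poly S) =
      Polynomial.order x [:- x, 1:] + Polynomial.order x (root_poly (S - {x}))"
    using root_poly_nonzero[of S] unfolding eq by (rule order_mult)
  ultimately show ?thesis by simp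
qed

section \<open>Vanishing to high order\<close>

text \<open>Multiplicity at z is read off after moving z to the origin, which is valid in every
  characteristic.\<close>

lemma monom_dvd_translate_imp:
  fixes p :: "'a::field poly"
  assumes "monom 1 l dvd pcompose p [:z, 1:]"
  shows "[:- z, 1:] ^ l dvd p"
proof -
  from assms obtain k where k: "pcompose p [:z, 1:] = [:0, 1:] ^ l * k"
    by (auto simp: monom_altdef dvd_def)
  have "pcompose (pcompose p [:z, 1:]) [:- z, 1:] = pcompose p [:0, 1:]"
    by (simp add: pcompose_assoc[symmetric] pcompose_pCons)
  then have "p = pcompose ([:0, 1:] ^ l * k) [:- z, 1:]"
    using k by simp
  also have "\<dots> = [:- z, 1:] ^ l * pcompose k [:- z, 1:]"
  proof -
    have "pcompose ([:0, 1:] ^ l) [:- z, 1:] = [:- z, 1:] ^ l"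
      by (induction l) (simp_all add: pcompose_1 pcompose_mult pcompose_pCons)
    then show ?thesis by (simp add: pcompose_mult)
  qed
  finally show ?thesis by (metis dvd_triv_left)
qed

lemma sum_card_roots_le_degree:
  fixes p :: "'a::field poly"
  assumes "p \<noteq> 0" "finite B" "\<And>z. z \<in> B \<Longrightarrow> [:- z, 1:] ^ l dvd p" "l > 0"
  shows "l * card B \<le> degree p"
proof -
  have sub: "B \<subseteq> {z. poly p z = 0}"
  proof
    fix z assume "z \<in> B"
    then have "[:- z, 1:] ^ l dvd p" by (rule assms(3))
    then have "[:- z, 1:] ^ 1 dvd p" using assms(4) by (auto intro: power_le_dvd)
    then show "z \<in> {z. poly p z = 0}" by (simp add: poly_eq_0_iff_dvd)
  qed
  have "l * card B = (\<Sum>z\<in>B. l)" by simp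
  also have "\<dots> \<le> (\<Sum>z\<in>B. Polynomial.order z p)"
    using assms by (intro sum_mono) (auto simp: order_divides)
  also have "\<dots> \<le> (\<Sum>z | poly p z = 0. Polynomial.order z p)"
    using sub assms(1) by (intro sum_mono2) (auto simp: poly_roots_finite)
  also have "\<dots> \<le> degree p" by (rule sum_order_le_degree[OF assms(1)])
  finally show ?thesis .
qed

section \<open>Independence of the blocks of Stepanov's polynomial\<close>

text \<open>Each factor satisfies (X - x)^q = X^q - x, so modulo X^q only the product of the -x
  survives, which is f(0).\<close>

lemma root_poly_power_card_cong:
  fixes S :: "'a::{field,finite} set"
  shows "[root_poly S ^ CARD('a) = [:poly (root_poly S) 0:]] (mod (monom 1 CARD('a)))"
proof -
  have "root_poly S ^ CARD('a) = (\<Prod>x\<in>S. monom 1 CARD('a) + [:- x:])"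
    by (simp add: root_poly_def prod_power_distrib linear_poly_power_card)
  also have "[\<dots> = (\<Prod>x\<in>S. [:- x:])] (mod (monom 1 CARD('a)))"
    by (rule cong_prod) (simp add: cong_iff_dvd_diff)
  also have "(\<Prod>x\<in>S. [:- x:]) = [:\<Prod>x\<in>S. - x:]"
    by (induction S rule: infinite_finite_induct) auto
  finally show ?thesis by (simp add: poly_root_poly)
qed

text \<open>Comparing the multiplicities of a root of \<open>f\<close> on both sides of \<open>f r\<^sup>2 = c s\<^sup>2\<close> forces \<open>r = s = 0\<close>.\<close>

lemma stepanov_independent_step:
  fixes S :: "'a::{field,finite} set"
  assumes q: "CARD('a) = 2 * M + 1" and S: "S \<noteq> {}" "0 \<notin> S"
    and D: "card S + 2 * D \<le> CARD('a) + 1"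
    and rs: "r \<in> polys_below D" "s \<in> polys_below D"
    and dvd: "monom 1 CARD('a) dvd r + s * root_poly S ^ M"
  shows "r = 0 \<and> s = 0"
proof (cases "D = 0")
  case True
  then show ?thesis using rs by (auto simp: polys_below_iff)
next
  case False
  define f where "f = root_poly S"
  define c where "c = poly f 0"
  have c: "c \<noteq> 0"
    unfolding c_def f_def poly_root_poly using S(2) by (auto simp: prod_zero_iff)
  have deg: "degree p \<le> D - 1" if "p \<in> polys_below D" for p :: "'a poly"
    using that False by (auto simp: polys_below_iff)
  \<comment> \<open>The conjugate factor removes the mixed term, and the extra f completes f^(2M) to
    f^q, whose residue modulo X^q is a constant.\<close>
  have "monom 1 CARD('a) dvd (r + s * f ^ M) * (f * (r - s * f ^ M))"
    using dvd by (simp add: f_def)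
  also have "(r + s * f ^ M) * (f * (r - s * f ^ M)) = f * r\<^sup>2 - f ^ CARD('a) * s\<^sup>2"
  proof -
    have "f ^ CARD('a) = f * (f ^ M * f ^ M)"
      by (simp add: q mult_2 power_add)
    then show ?thesis by (simp add: power2_eq_square algebra_simps)
  qed
  finally have "[f * r\<^sup>2 = f ^ CARD('a) * s\<^sup>2] (mod (monom 1 CARD('a)))"
    by (simp add: cong_iff_dvd_diff)
  also have "[f ^ CARD('a) * s\<^sup>2 = [:c:] * s\<^sup>2] (mod (monom 1 CARD('a)))"
    unfolding f_def c_def by (intro cong_mult root_poly_power_card_cong cong_refl)
  finally have "monom 1 CARD('a) dvd f * r\<^sup>2 - smult c (s\<^sup>2)"
    by (simp add: cong_iff_dvd_diff)
  \<comment> \<open>The hypothesis on D enters here: |S| + 2 (D - 1) < q, so the congruence modulo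
    X^q is an equality.\<close>
  moreover have "degree (f * r\<^sup>2 - smult c (s\<^sup>2)) < CARD('a)"
  proof (rule degree_diff_less)
    have "degree (f * r\<^sup>2) \<le> card S + (D - 1) * 2"
      using deg[OF rs(1)] unfolding f_def
      by (intro order.trans[OF degree_mult_le] add_mono order.trans[OF degree_power_le])
         (auto simp: degree_root_poly)
    then show "degree (f * r\<^sup>2) < CARD('a)" using D False by linarith
    have "degree (smult c (s\<^sup>2)) \<le> (D - 1) * 2"
      using deg[OF rs(2)]
      by (intro order.trans[OF degree_smult_le] order.trans[OF degree_power_le]) auto
    then show "degree (smult c (s\<^sup>2)) < CARD('a)" using D False by linarith
  qed
  ultimately have eq: "f * r\<^sup>2 = smult c (s\<^sup>2)"
    using dvd_imp_degree_le[of "monom 1 CARD('a)" "f * r\<^sup>2 - smult c (s\<^sup>2)"]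
    by (auto simp: degree_monom_eq)
  have f0: "f \<noteq> 0" by (simp add: f_def root_poly_nonzero)
  obtain x where x: "x \<in> S" using S by blast
  have "\<not> (r \<noteq> 0 \<and> s \<noteq> 0)"
  proof
    assume nz: "r \<noteq> 0 \<and> s \<noteq> 0"
    have "Polynomial.order x (f * r\<^sup>2) = 1 + 2 * Polynomial.order x r"
      using nz f0 order_root_poly[OF _ x] by (simp add: order_mult power2_eq_square f_def)
    moreover have "Polynomial.order x (smult c (s\<^sup>2)) = 2 * Polynomial.order x s"
      using nz c by (simp add: order_smult order_mult power2_eq_square)
    ultimately have "1 + 2 * Polynomial.order x r = 2 * Polynomial.order x s" using eq by simp
    then show False by presburger
  qed
  then show ?thesis using eq c f0 by auto
qed

text \<open>The blocks can overlap, because f^M may have degree beyond q, so coefficients cannot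
  simply be compared. Instead, once the blocks before j are known to vanish, cancel X^(jq): all
  later blocks are multiples of X^q, hence block j vanishes modulo X^q and the one-block case
  applies.\<close>

lemma stepanov_independent:
  fixes S :: "'a::{field,finite} set"
  assumes q: "CARD('a) = 2 * M + 1" and S: "S \<noteq> {}" "0 \<notin> S"
    and D: "card S + 2 * D \<le> CARD('a) + 1"
    and rs: "\<And>j. j < J \<Longrightarrow> r j \<in> polys_below D" "\<And>j. j < J \<Longrightarrow> s j \<in> polys_below D"
    and zero: "(\<Sum>j<J. (r j + s j * root_poly S ^ M) * monom 1 (j * CARD('a))) = 0"
  shows "j < J \<Longrightarrow> r j = 0 \<and> s j = 0"
proof (induction j rule: less_induct)
  case (less j)
  let ?q = "CARD('a)"
  let ?t = "\<lambda>j. r j + s j * root_poly S ^ M"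
  have mon: "monom 1 (i * ?q) = monom (1::'a) (j * ?q) * monom 1 ?q * monom 1 ((i - Suc j) * ?q)"
    if "i > j" for i
  proof -
    have "i = j + 1 + (i - Suc j)" using that by simp
    then have "i * ?q = (j + 1 + (i - Suc j)) * ?q" by (rule arg_cong)
    also have "\<dots> = j * ?q + ?q + (i - Suc j) * ?q"
      by (simp only: distrib_right mult_1)
    finally show ?thesis by (simp only: mult_monom mult_1)
  qed
  have split: "sum g {..<J} = sum g {..<j} + g j + sum g {j<..<J}" for g :: "nat \<Rightarrow> 'a poly"
  proof -
    have "{..<J} = ({..<j} \<union> {j}) \<union> {j<..<J}" using less.prems by auto
    then have "sum g {..<J} = sum g (({..<j} \<union> {j}) \<union> {j<..<J})" by (rule arg_cong)
    also have "\<dots> = sum g ({..<j} \<union> {j}) + sum g {j<..<J}"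
      by (rule sum.union_disjoint) auto
    also have "sum g ({..<j} \<union> {j}) = sum g {..<j} + g j"
      by (subst sum.union_disjoint) auto
    finally show ?thesis .
  qed
  define w where "w i = ?t i * monom 1 (i * ?q)" for i
  define Z where "Z = (\<Sum>i\<in>{j<..<J}. ?t i * monom 1 ((i - Suc j) * ?q))"
  have "sum w {..<j} = 0"
    using less by (intro sum.neutral) (auto simp: w_def)
  moreover have "sum w {j<..<J} = monom 1 (j * ?q) * (monom 1 ?q * Z)"
    unfolding Z_def sum_distrib_left
    by (intro sum.cong refl) (simp only: w_def mon greaterThanLessThan_iff mult_ac)
  moreover have "w j = monom 1 (j * ?q) * ?t j"
    by (simp only: w_def mult_ac)
  ultimately have "monom 1 (j * ?q) * (?t j + monom 1 ?q * Z) = 0"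
    using zero split[of w] by (simp only: w_def[symmetric] distrib_left add_0_left)
  then have "?t j + monom 1 ?q * Z = 0"
    by (metis mult_eq_0_iff monom_eq_0_iff one_neq_zero)
  then have "?t j = monom 1 ?q * (- Z)"
    by (metis add_eq_0_iff2 mult_minus_right)
  then have "monom 1 ?q dvd ?t j" by (metis dvd_triv_left)
  then show ?case
    using stepanov_independent_step[OF q S D rs] less.prems by blast
qed

section \<open>Truncated expansion of a high power at a point\<close>

lemma pcompose_power: "pcompose (p ^ n) r = pcompose p r ^ n"
  for p :: "'a::comm_ring_1 poly"
  by (induction n) (simp_all add: pcompose_1 pcompose_mult)

lemma smult_sum_right: "smult c (\<Sum>i\<in>I. p i) = (\<Sum>i\<in>I. smult c (p i))"
  by (induction I rule: infinite_finite_induct) (simp_all add: smult_add_right)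

text \<open>With u = f(z + X) - f(z), this is the binomial expansion of (f(z) + u)^M cut off before
  u^l and rescaled by f(z)^(l - M). The rescaling turns the exponents M - i into l - i, so that M
  does not enter the degree in z.\<close>

definition binomial_jet :: "'a::comm_ring_1 poly \<Rightarrow> nat \<Rightarrow> nat \<Rightarrow> 'a \<Rightarrow> 'a poly" where
  "binomial_jet f M l z = (\<Sum>i<l. smult (of_nat (M choose i) * poly f z ^ (l - i))
     ((pcompose f [:z, 1:] - [:poly f z:]) ^ i))"

lemma binomial_jet_polyfams:
  fixes f :: "'a::field poly"
  shows "(\<lambda>z. binomial_jet f M l z) \<in> polyfams (l * degree f)"
  unfolding binomial_jet_def
proof (rule polyfams_sum)
  fix i assume i: "i \<in> {..<l}"
  have "(\<lambda>z. pcompose f [:z, 1:] + [:poly (- f) z:]) \<in> polyfams (degree f)"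
    by (intro polyfams_add polyfams_translate polyfams_const_poly polyfuns_poly) simp
  moreover have "pcompose f [:z, 1:] + [:poly (- f) z:] = pcompose f [:z, 1:] - [:poly f z:]" for z
    by simp
  ultimately have "(\<lambda>z. pcompose f [:z, 1:] - [:poly f z:]) \<in> polyfams (degree f)"
    by (simp only:)
  then have "(\<lambda>z. (pcompose f [:z, 1:] - [:poly f z:]) ^ i) \<in> polyfams (i * degree f)"
    by (rule polyfams_power)
  moreover have "(\<lambda>z. of_nat (M choose i) * poly f z ^ (l - i)) \<in> polyfuns (0 + (l - i) * degree f)"
    by (intro polyfuns_mult polyfuns_const polyfuns_power polyfuns_poly order.refl)
  ultimately have "(\<lambda>z. smult (of_nat (M choose i) * poly f z ^ (l - i))
      ((pcompose f [:z, 1:] - [:poly f z:]) ^ i)) \<in> polyfams (0 + (l - i) * degree f + i * degree f)"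
    by (intro polyfams_smult)
  moreover have "0 + (l - i) * degree f + i * degree f = l * degree f"
    using i by (simp add: add_mult_distrib[symmetric])
  ultimately show "(\<lambda>z. smult (of_nat (M choose i) * poly f z ^ (l - i))
      ((pcompose f [:z, 1:] - [:poly f z:]) ^ i)) \<in> polyfams (l * degree f)"
    by simp
qed

text \<open>The jet of \<open>f\<^sup>M\<close> at \<open>z\<close> depends on \<open>z\<close> only through the low powers of \<open>f(z)\<close> once
  \<open>f(z)\<^sup>M\<close> is known.\<close>

lemma binomial_jet_cong:
  fixes f :: "'a::field poly"
  assumes "l \<le> M"
  shows "[smult (poly f z ^ l) (pcompose f [:z, 1:] ^ M) =
    smult (poly f z ^ M) (binomial_jet f M l z)] (mod (monom 1 l))"
proof -
  define c where "c = poly f z"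
  define u where "u = pcompose f [:z, 1:] - [:c:]"
  have "poly u 0 = 0" by (simp add: u_def c_def poly_pcompose)
  then have "monom 1 1 dvd u"
    by (simp add: poly_eq_0_iff_dvd monom_altdef)
  have u: "monom 1 l dvd u ^ i" if "i \<ge> l" for i
  proof -
    have "monom 1 1 ^ i dvd u ^ i" using \<open>monom 1 1 dvd u\<close> by (rule dvd_power_same)
    moreover have "monom (1::'a) l dvd monom 1 1 ^ i"
      using that by (simp add: monom_altdef le_imp_power_dvd)
    ultimately show ?thesis by (rule dvd_trans[rotated])
  qed
  have "smult (c ^ l) (pcompose f [:z, 1:] ^ M) = smult (c ^ l) ((u + [:c:]) ^ M)"
    by (simp add: u_def)
  also have "\<dots> = (\<Sum>i\<le>M. smult (of_nat (M choose i) * c ^ (M - i) * c ^ l) (u ^ i))"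
    unfolding binomial_ring smult_sum_right
    by (intro sum.cong refl) (simp add: poly_const_pow of_nat_poly mult_ac smult_smult)
  also have "{..M} = {..<l} \<union> {l..M}" using assms by auto
  also have "(\<Sum>i\<in>{..<l} \<union> {l..M}. smult (of_nat (M choose i) * c ^ (M - i) * c ^ l) (u ^ i)) =
     (\<Sum>i\<in>{..<l}. smult (of_nat (M choose i) * c ^ (M - i) * c ^ l) (u ^ i)) +
     (\<Sum>i\<in>{l..M}. smult (of_nat (M choose i) * c ^ (M - i) * c ^ l) (u ^ i))"
    by (rule sum.union_disjoint) auto
  also have "(\<Sum>i\<in>{..<l}. smult (of_nat (M choose i) * c ^ (M - i) * c ^ l) (u ^ i)) =
     smult (c ^ M) (binomial_jet f M l z)"
    unfolding binomial_jet_def smult_sum_right c_def[symmetric] u_def[symmetric]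
  proof (intro sum.cong refl)
    fix i assume "i \<in> {..<l}"
    then have "c ^ (M - i) * c ^ l = c ^ M * c ^ (l - i)"
      using assms by (simp add: power_add[symmetric])
    then have "of_nat (M choose i) * c ^ (M - i) * c ^ l =
        c ^ M * (of_nat (M choose i) * c ^ (l - i))"
      by (simp add: mult_ac)
    then show "smult (of_nat (M choose i) * c ^ (M - i) * c ^ l) (u ^ i) =
        smult (c ^ M) (smult (of_nat (M choose i) * c ^ (l - i)) (u ^ i))"
      by (simp only: smult_smult)
  qed
  finally have eq: "smult (c ^ l) (pcompose f [:z, 1:] ^ M) - smult (c ^ M) (binomial_jet f M l z) =
     (\<Sum>i\<in>{l..M}. smult (of_nat (M choose i) * c ^ (M - i) * c ^ l) (u ^ i))"
    by simp
  have "monom 1 l dvd (\<Sum>i\<in>{l..M}. smult (of_nat (M choose i) * c ^ (M - i) * c ^ l) (u ^ i))"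
    by (intro dvd_sum dvd_smult u) simp
  then show ?thesis
    unfolding cong_iff_dvd_diff c_def[symmetric] eq .
qed

section \<open>The auxiliary polynomial and the resulting point count\<close>

text \<open>The 2J polynomials \<open>r j\<close>, \<open>s j\<close> offer q^(2DJ) choices.
  Vanishing to order l is enforced through l functions of z, each of degree at most T = J + l |S| +
  D, hence through at most q^((T + 1) l) values. The hypothesis \<open>count\<close> says that the
  choices outnumber the values.\<close>

lemma stepanov_auxiliary_poly:
  fixes S :: "'a::{field,finite} set"
  defines "f \<equiv> root_poly S"
  assumes q: "CARD('a) = 2 * M + 1" and S: "S \<noteq> {}" "0 \<notin> S"
    and D: "card S + 2 * D \<le> CARD('a) + 1" and lM: "l \<le> M"
    and count: "(J + (l * card S + D) + 1) * l < 2 * D * J"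
  obtains R where "R \<noteq> 0" "degree R \<le> D + M * card S + (J - 1) * CARD('a)"
    "\<And>z. poly f z \<noteq> 0 \<Longrightarrow> poly f z ^ M = a \<Longrightarrow> [:- z, 1:] ^ l dvd R"
proof -
  let ?q = "CARD('a)"
  define G where "G = binomial_jet f M l"
  \<comment> \<open>What f(z)^l R(z + X) becomes modulo X^l when f(z)^M = a: X^(jq) turns into z^j,
    and f^M into a multiple of its jet. \<open>W\<close> makes sense for every z and is polynomial
    in z, which is what makes the count possible.\<close>
  define W where "W r s z = (\<Sum>j<J. smult (z ^ j) (smult (poly f z ^ l) (pcompose (r j) [:z, 1:])
     + smult a (pcompose (s j) [:z, 1:]) * G z))" for r s :: "nat \<Rightarrow> 'a poly" and z
  define T where "T = J + (l * card S + D)"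
  define V :: "(nat \<Rightarrow> 'a poly \<times> 'a poly) set"
    where "V = {..<J} \<rightarrow>\<^sub>E polys_below D \<times> polys_below D"
  define \<Phi> where "\<Phi> v = restrict (\<lambda>i z. coeff (W (\<lambda>j. fst (v j)) (\<lambda>j. snd (v j)) z) i) {..<l}"
    for v :: "nat \<Rightarrow> 'a poly \<times> 'a poly"
  have degf: "degree f = card S" by (simp add: f_def degree_root_poly)
  have transl: "(\<lambda>z. pcompose p [:z, 1:]) \<in> polyfams D" if "p \<in> polys_below D" for p :: "'a poly"
    using that by (auto simp: polys_below_iff polyfams_const intro: polyfams_mono[OF polyfams_translate])
  have W: "(\<lambda>z. W r s z) \<in> polyfams T"
    if rs: "\<And>j. j < J \<Longrightarrow> r j \<in> polys_below D" "\<And>j. j < J \<Longrightarrow> s j \<in> polys_below D" for r s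
    unfolding W_def T_def
  proof (rule polyfams_sum)
    fix j assume j: "j \<in> {..<J}"
    have "(\<lambda>z::'a. z) \<in> polyfuns 1"
      using polyfuns_poly[of "[:0, 1::'a:]" 1] by (simp add: poly_pCons[abs_def])
    then have "(\<lambda>z::'a. z ^ j) \<in> polyfuns (j * 1)" by (rule polyfuns_power)
    then have z: "(\<lambda>z::'a. z ^ j) \<in> polyfuns J" using j by (auto elim: polyfuns_mono)
    have 1: "(\<lambda>z. smult (poly f z ^ l) (pcompose (r j) [:z, 1:])) \<in> polyfams (l * card S + D)"
      using j rs by (intro polyfams_smult polyfuns_power polyfuns_poly transl) (auto simp: degf)
    have "(\<lambda>z. smult a (pcompose (s j) [:z, 1:]) * G z) \<in> polyfams (0 + D + l * card S)"
      unfolding G_def using binomial_jet_polyfams[of f M l] j rs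
      by (intro polyfams_mult polyfams_smult polyfuns_const transl) (auto simp: degf)
    then have 2: "(\<lambda>z. smult a (pcompose (s j) [:z, 1:]) * G z) \<in> polyfams (l * card S + D)"
      by (simp add: add.commute)
    show "(\<lambda>z. smult (z ^ j) (smult (poly f z ^ l) (pcompose (r j) [:z, 1:])
        + smult a (pcompose (s j) [:z, 1:]) * G z)) \<in> polyfams (J + (l * card S + D))"
      by (rule polyfams_smult[OF z polyfams_add[OF 1 2]])
  qed
  have "\<Phi> ` V \<subseteq> ({..<l} \<rightarrow>\<^sub>E polyfuns T)"
  proof
    fix h assume "h \<in> \<Phi> ` V"
    then obtain v where v: "v \<in> V" "h = \<Phi> v" by blast
    have "(\<lambda>z. W (\<lambda>j. fst (v j)) (\<lambda>j. snd (v j)) z) \<in> polyfams T"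
      using v(1) by (intro W) (auto simp: V_def PiE_iff mem_Times_iff)
    then show "h \<in> {..<l} \<rightarrow>\<^sub>E polyfuns T"
      unfolding v(2) \<Phi>_def polyfams_def by auto
  qed
  then have "card (\<Phi> ` V) \<le> card ({..<l} \<rightarrow>\<^sub>E (polyfuns T :: ('a \<Rightarrow> 'a) set))"
    by (intro card_mono finite_PiE) auto
  also have "\<dots> \<le> (?q ^ Suc T) ^ l"
    using card_polyfuns_le[of T, where 'a='a] by (simp add: card_PiE power_mono)
  also have "\<dots> = ?q ^ ((T + 1) * l)" by (simp only: power_mult[symmetric] Suc_eq_plus1)
  also have "\<dots> < ?q ^ (2 * D * J)"
  proof (rule power_strict_increasing)
    have "D \<noteq> 0" using count by (intro notI) simp
    moreover have "card S > 0" using S(1) by (simp add: card_gt_0_iff)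
    ultimately show "1 < ?q" using D by linarith
  qed (use count in \<open>simp add: T_def\<close>)
  also have "\<dots> = card V"
    by (simp add: V_def card_PiE card_cartesian_product card_polys_below power_mult power2_eq_square power_mult_distrib)
  finally have "\<not> inj_on \<Phi> V" by (rule pigeonhole)
  then obtain v v' where v: "v \<in> V" "v' \<in> V" "\<Phi> v = \<Phi> v'" "v \<noteq> v'"
    by (auto simp: inj_on_def)
  \<comment> \<open>\<open>W\<close> is additive in r and s, so the difference of two choices with
    the same image lies in the kernel.\<close>
  define r where "r j = fst (v j) - fst (v' j)" for j
  define s where "s j = snd (v j) - snd (v' j)" for j
  have rs: "r j \<in> polys_below D" "s j \<in> polys_below D" if "j < J" for j
    using v(1,2) that unfolding r_def s_def V_def
    by (auto simp: PiE_iff mem_Times_iff intro!: polys_below_diff)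
  have W0: "monom 1 l dvd W r s z" for z
    unfolding monom_1_dvd_iff'
  proof (intro allI impI)
    fix i assume "i < l"
    have "W r s z = W (\<lambda>j. fst (v j)) (\<lambda>j. snd (v j)) z - W (\<lambda>j. fst (v' j)) (\<lambda>j. snd (v' j)) z"
      unfolding W_def r_def s_def sum_subtractf[symmetric]
      by (intro sum.cong refl) (simp add: pcompose_diff smult_diff_right algebra_simps)
    moreover have "coeff (W (\<lambda>j. fst (v j)) (\<lambda>j. snd (v j)) z) i =
        coeff (W (\<lambda>j. fst (v' j)) (\<lambda>j. snd (v' j)) z) i"
      using fun_cong[OF fun_cong[OF v(3), of i], of z] \<open>i < l\<close> by (simp add: \<Phi>_def)
    ultimately show "coeff (W r s z) i = 0" by simp
  qed
  define R where "R = (\<Sum>j<J. (r j + s j * f ^ M) * monom 1 (j * ?q))"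
  show thesis
  proof
    show "R \<noteq> 0"
    proof
      assume "R = 0"
      then have "r j = 0 \<and> s j = 0" if "j < J" for j
        using \<open>R = 0\<close> that unfolding R_def f_def
        by (intro stepanov_independent[OF q S D rs])
      then have "v j = v' j" if "j < J" for j
        using that by (simp add: r_def s_def prod_eq_iff)
      then have "v = v'"
        using v(1,2) unfolding V_def by (intro PiE_ext) auto
      then show False using v(4) by blast
    qed
    show "degree R \<le> D + M * card S + (J - 1) * ?q"
      unfolding R_def
    proof (intro degree_sum_le)
      fix j assume j: "j \<in> {..<J}"
      have d: "degree p \<le> D" if "p \<in> polys_below D" for p :: "'a poly"
        using that by (auto simp: polys_below_iff)
      have "degree (s j * f ^ M) \<le> D + M * card S"
        using d[OF rs(2)] j degree_power_le[of f M]
        by (intro order.trans[OF degree_mult_le] add_mono) (auto simp: degf mult.commute)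
      then have "degree (r j + s j * f ^ M) \<le> D + M * card S"
        using d[OF rs(1)] j by (intro degree_add_le) (auto intro: trans_le_add1)
      moreover have "degree (monom (1::'a) (j * ?q)) \<le> (J - 1) * ?q"
        using j by (auto simp: degree_monom_eq intro: mult_le_mono1)
      ultimately show "degree ((r j + s j * f ^ M) * monom 1 (j * ?q)) \<le> D + M * card S + (J - 1) * ?q"
        by (intro order.trans[OF degree_mult_le] add_mono)
    qed simp
    fix z assume z: "poly f z \<noteq> 0" "poly f z ^ M = a"
    have lq: "monom (1::'a) l dvd monom 1 ?q"
    proof -
      have "l \<le> ?q" using lM q by linarith
      then show ?thesis by (simp only: monom_altdef smult_1_left le_imp_power_dvd)
    qed
    have "[monom 1 ?q + [:z:] = [:z:]] (mod (monom 1 l))"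
      using lq by (simp add: cong_iff_dvd_diff)
    then have pow: "[(monom 1 ?q + [:z:]) ^ j = [:z:] ^ j] (mod (monom 1 l))" for j
      by (rule cong_pow)
    \<comment> \<open>Frobenius gives (z + X)^q = X^q + z, and X^q vanishes modulo X^l because l is
      at most q.\<close>
    have mon: "[pcompose (monom 1 (j * ?q)) [:z, 1:] = [:z ^ j:]] (mod (monom 1 l))" for j
    proof -
      have "pcompose (monom 1 (j * ?q)) [:z, 1:] = [:z, 1:] ^ (?q * j)"
        by (simp only: monom_altdef smult_1_left pcompose_power mult.commute[of j])
           (simp add: pcompose_pCons)
      also have "\<dots> = (monom 1 ?q + [:z:]) ^ j"
        by (simp only: power_mult linear_poly_power_card)
      finally show ?thesis using pow[of j]
        by (simp only: poly_const_pow)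
    qed
    have 1: "smult (poly f z ^ l) (pcompose R [:z, 1:]) =
      (\<Sum>j<J. (smult (poly f z ^ l) (pcompose (r j) [:z, 1:]) +
         pcompose (s j) [:z, 1:] * smult (poly f z ^ l) (pcompose f [:z, 1:] ^ M)) *
         pcompose (monom 1 (j * ?q)) [:z, 1:])"
      unfolding R_def pcompose_sum smult_sum_right
      by (intro sum.cong refl)
         (simp only: pcompose_mult pcompose_add pcompose_power smult_add_right distrib_right
            mult_smult_left mult_smult_right)
    have 2: "[(\<Sum>j<J. (smult (poly f z ^ l) (pcompose (r j) [:z, 1:]) +
         pcompose (s j) [:z, 1:] * smult (poly f z ^ l) (pcompose f [:z, 1:] ^ M)) *
         pcompose (monom 1 (j * ?q)) [:z, 1:]) =
       (\<Sum>j<J. (smult (poly f z ^ l) (pcompose (r j) [:z, 1:]) +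
         pcompose (s j) [:z, 1:] * smult (poly f z ^ M) (G z)) * [:z ^ j:])] (mod (monom 1 l))"
      unfolding G_def
      by (rule cong_sum, rule cong_mult[OF cong_add[OF cong_refl
            cong_mult[OF cong_refl binomial_jet_cong[OF lM]]] mon])
    have 3: "(\<Sum>j<J. (smult (poly f z ^ l) (pcompose (r j) [:z, 1:]) +
         pcompose (s j) [:z, 1:] * smult (poly f z ^ M) (G z)) * [:z ^ j:]) = W r s z"
    proof -
      have "p * [:c:] = smult c p" for p and c :: 'a by simp
      then show ?thesis
        unfolding W_def z(2) by (simp only: mult_smult_left mult_smult_right)
    qed
    have "[smult (poly f z ^ l) (pcompose R [:z, 1:]) = W r s z] (mod (monom 1 l))"
      unfolding 1 using 2 unfolding 3 .
    then have "monom 1 l dvd smult (poly f z ^ l) (pcompose R [:z, 1:])"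
      by (rule cong_dvd_iff[THEN iffD2]) (rule W0)
    \<comment> \<open>The factor f(z)^l, introduced to avoid negative powers of f(z), is a nonzero
      constant at this z.\<close>
    then have "monom 1 l dvd pcompose R [:z, 1:]"
      using z(1) by (simp add: dvd_smult_iff)
    then show "[:- z, 1:] ^ l dvd R"
      by (rule monom_dvd_translate_imp)
  qed
qed

text \<open>Divided by 2k, the bound reads q/2 + |S| q / (2k): half of the field up to a relative
  error |S| / k. It is the degree of R divided by the order of vanishing l = 2k, with J = k + 1
  blocks.\<close>

lemma stepanov_bound_aux:
  fixes S :: "'a::{field,finite} set"
  assumes q: "CARD('a) = 2 * M + 1" and S: "S \<noteq> {}" "0 \<notin> S" and a: "a \<noteq> 0"
    and k: "k > 0" "12 * card S * k\<^sup>2 < CARD('a)"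
  shows "2 * k * card {z. poly (root_poly S) z ^ M = a} \<le> (k + card S) * CARD('a)"
proof -
  let ?q = "CARD('a)"
  define s where "s = card S"
  \<comment> \<open>The largest D that the independence of the blocks admits; it is close to
    q/2.\<close>
  define D where "D = (?q + 1 - s) div 2"
  have s: "s > 0" unfolding s_def using S(1) by (simp add: card_gt_0_iff)
  have k2: "k \<le> k\<^sup>2" using k(1) by (simp add: power2_eq_square)
  have sk: "k\<^sup>2 \<le> s * k\<^sup>2" "s \<le> s * k\<^sup>2" using s k(1) by auto
  have q12: "12 * (s * k\<^sup>2) < ?q" using k(2) by (simp add: s_def mult.assoc)
  have sD: "s + 2 * D \<le> ?q + 1" "?q \<le> s + 2 * D"
    unfolding D_def using q12 sk by linarith+
  have M: "2 * k \<le> M" using q q12 k2 sk by linarith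
  \<comment> \<open>The terms 2Dk agree on both sides, so D must exceed k^2 + 2k + 2sk^2, which is
    at most 5sk^2. The constant 12 gives D > 11/2 sk^2, after the loss of s in D.\<close>
  have "(k + 1 + (2 * k * s + D) + 1) * (2 * k) = 2 * (k\<^sup>2 + 2 * k + 2 * (s * k\<^sup>2)) + 2 * D * k"
    by (simp add: algebra_simps power2_eq_square)
  also have "\<dots> < 2 * D + 2 * D * k"
  proof -
    have "K + 2 * k + 2 * P < D"
      if "?q \<le> s + 2 * D" "12 * P < ?q" "k \<le> K" "K \<le> P" "s \<le> P" for K P :: nat
      using that by linarith
    from this[OF sD(2) q12 k2 sk] show ?thesis by simp
  qed
  also have "\<dots> = 2 * D * (k + 1)" by simp
  finally have count: "(k + 1 + (2 * k * card S + D) + 1) * (2 * k) < 2 * D * (k + 1)"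
    by (simp add: s_def)
  obtain R where R: "R \<noteq> 0" "degree R \<le> D + M * card S + (k + 1 - 1) * ?q"
    "\<And>z. poly (root_poly S) z \<noteq> 0 \<Longrightarrow> poly (root_poly S) z ^ M = a \<Longrightarrow> [:- z, 1:] ^ (2 * k) dvd R"
    using stepanov_auxiliary_poly[OF q S _ M count, of a] sD(1) unfolding s_def by blast
  have "M > 0" using M k(1) by linarith
  have "2 * k * card {z. poly (root_poly S) z ^ M = a} \<le> degree R"
  proof (rule sum_card_roots_le_degree[OF R(1)])
    fix z assume "z \<in> {z. poly (root_poly S) z ^ M = a}"
    then have "poly (root_poly S) z ^ M = a" by simp
    moreover from this have "poly (root_poly S) z \<noteq> 0"
      using a \<open>M > 0\<close> by (auto simp: power_0_left)
    ultimately show "[:- z, 1:] ^ (2 * k) dvd R" using R(3) by blast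
  qed (use k in auto)
  also have "\<dots> \<le> D + M * s + k * ?q" using R(2) by (simp add: s_def)
  also have "D + M * s \<le> s * ?q"
  proof -
    have "2 * (M * s) + s = s * ?q" using q by (simp add: algebra_simps)
    moreover have "?q \<le> s * ?q" using s by simp
    ultimately show ?thesis using sD s by linarith
  qed
  finally show ?thesis by (simp add: s_def algebra_simps)
qed

text \<open>A translation by a point outside S removes the restriction that 0 is not in S, which
  made f(0) invertible in the independence argument.\<close>

lemma stepanov_bound:
  fixes S :: "'a::{field,finite} set"
  assumes q: "CARD('a) = 2 * M + 1" and S: "S \<noteq> {}" and a: "a \<noteq> 0"
    and k: "k > 0" "12 * card S * k\<^sup>2 < CARD('a)"
  shows "2 * k * card {z. poly (root_poly S) z ^ M = a} \<le> (k + card S) * CARD('a)"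
proof -
  have "card S \<le> 12 * card S * k\<^sup>2" using k(1) by auto
  then have "S \<noteq> UNIV" using k(2) by auto
  then obtain t where t: "t \<notin> S" by blast
  define S' where "S' = (\<lambda>x. x - t) ` S"
  have card: "card S' = card S"
    unfolding S'_def by (intro card_image) (simp add: inj_on_def)
  have "poly (root_poly S') (z - t) = poly (root_poly S) z" for z
    unfolding poly_root_poly S'_def by (subst prod.reindex) (auto simp: inj_on_def)
  then have "{z. poly (root_poly S') z ^ M = a} = (\<lambda>z. z - t) ` {z. poly (root_poly S) z ^ M = a}"
    by (auto simp: image_iff) (metis add_diff_cancel)
  then have "card {z. poly (root_poly S') z ^ M = a} = card {z. poly (root_poly S) z ^ M = a}"
    by (simp add: card_image inj_on_def)
  moreover have "2 * k * card {z. poly (root_poly S') z ^ M = a} \<le> (k + card S') * CARD('a)"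
  proof (rule stepanov_bound_aux[OF q _ _ a k(1)])
    show "12 * card S' * k\<^sup>2 < CARD('a)" unfolding card by (rule k(2))
  qed (use S t in \<open>auto simp: S'_def\<close>)
  ultimately show ?thesis by (simp add: card)
qed

section \<open>Sign patterns\<close>

text \<open>The product over A of \<open>\<epsilon> x * \<psi> c x + 1\<close> vanishes unless c
  realises the pattern. Summed over c and expanded over subsets of A, the empty subset contributes
  |P|, and by \<open>bias\<close> the other subsets cannot cancel it.\<close>

lemma sign_pattern_exists:
  fixes \<psi> :: "'c \<Rightarrow> 'x \<Rightarrow> real"
  assumes fin: "finite P" "finite A"
    and sign: "\<And>c x. c \<in> P \<Longrightarrow> x \<in> A \<Longrightarrow> \<psi> c x = 1 \<or> \<psi> c x = -1"
    and bias: "(\<Sum>S\<in>Pow A - {{}}. \<bar>\<Sum>c\<in>P. \<Prod>x\<in>S. \<psi> c x\<bar>) < real (card P)"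
  shows "\<exists>c\<in>P. \<forall>x\<in>A. \<psi> c x = 1 \<longleftrightarrow> x \<in> E"
proof (rule ccontr)
  assume none: "\<not> ?thesis"
  define \<epsilon> :: "'x \<Rightarrow> real" where "\<epsilon> x = (if x \<in> E then 1 else -1)" for x
  define T where "T S = (\<Sum>c\<in>P. \<Prod>x\<in>S. \<psi> c x)" for S
  have "(\<Prod>x\<in>A. \<epsilon> x * \<psi> c x + 1) = 0" if "c \<in> P" for c
  proof -
    have "\<not> (\<forall>x\<in>A. \<psi> c x = 1 \<longleftrightarrow> x \<in> E)"
    proof
      assume "\<forall>x\<in>A. \<psi> c x = 1 \<longleftrightarrow> x \<in> E"
      with that have "\<exists>c\<in>P. \<forall>x\<in>A. \<psi> c x = 1 \<longleftrightarrow> x \<in> E" by (rule bexI[rotated])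
      with none show False by (rule notE)
    qed
    then obtain x where x: "x \<in> A" "(\<psi> c x = 1) \<noteq> (x \<in> E)" by blast
    then have "\<epsilon> x * \<psi> c x + 1 = 0" using sign[OF that x(1)] by (auto simp: \<epsilon>_def)
    then show ?thesis using x(1) fin(2) by (auto simp: prod_zero_iff)
  qed
  then have "0 = (\<Sum>c\<in>P. \<Prod>x\<in>A. \<epsilon> x * \<psi> c x + 1)" by simp
  also have "\<dots> = (\<Sum>c\<in>P. \<Sum>S\<in>Pow A. (\<Prod>x\<in>S. \<epsilon> x) * (\<Prod>x\<in>S. \<psi> c x))"
    using fin(2) by (simp add: prod_add prod.distrib)
  also have "\<dots> = (\<Sum>S\<in>Pow A. (\<Prod>x\<in>S. \<epsilon> x) * T S)"
    unfolding T_def sum_distrib_left by (rule sum.swap)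
  also have "\<dots> = T {} + (\<Sum>S\<in>Pow A - {{}}. (\<Prod>x\<in>S. \<epsilon> x) * T S)"
    using fin(2) by (subst sum.remove[of _ "{}"]) auto
  finally have "T {} \<le> \<bar>\<Sum>S\<in>Pow A - {{}}. (\<Prod>x\<in>S. \<epsilon> x) * T S\<bar>" by linarith
  also have "\<dots> \<le> (\<Sum>S\<in>Pow A - {{}}. \<bar>(\<Prod>x\<in>S. \<epsilon> x) * T S\<bar>)" by (rule sum_abs)
  also have "\<dots> = (\<Sum>S\<in>Pow A - {{}}. \<bar>T S\<bar>)"
    by (intro sum.cong refl) (simp add: abs_mult abs_prod \<epsilon>_def if_distrib[of abs] cong: if_cong)
  also have "\<dots> < real (card P)" using bias by (simp add: T_def)
  finally show False by (simp add: T_def)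
qed

text \<open>Serves both characteristics: squaring identifies t with -t, and t^2 + t in
  characteristic two identifies t with t + 1.\<close>

lemma card_two_to_one:
  assumes "finite X" "\<And>x. x \<in> X \<Longrightarrow> card {y \<in> X. f y = f x} = 2"
  shows "card X = 2 * card (f ` X)"
proof -
  have "(\<Sum>x\<in>X. 1) = (\<Sum>v\<in>f ` X. \<Sum>x\<in>{x \<in> X. f x = v}. 1::nat)"
    by (rule sum.image_gen[OF assms(1)])
  also have "\<dots> = (\<Sum>v\<in>f ` X. 2)"
    using assms(2) by (intro sum.cong refl) auto
  finally show ?thesis by simp
qed

section \<open>Odd characteristic: the quadratic character\<close>

lemma minus_one_neq_one:
  assumes "(2::'a::field) \<noteq> 0"
  shows "(-1::'a) \<noteq> 1"
proof
  assume "(-1::'a) = 1"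
  then have "(1::'a) + 1 = 0" by (metis add.right_inverse)
  with assms show False by simp
qed

text \<open>Besides the parity of q, this identifies the exponent M = (q - 1) / 2 as the number of
  nonzero squares, which is what Euler's criterion needs.\<close>

lemma card_odd_finite_field:
  assumes "(2::'a::{field,finite}) \<noteq> 0"
  shows "CARD('a) = 2 * card ((\<lambda>t::'a. t * t) ` (UNIV - {0})) + 1"
proof -
  have "card (UNIV - {0::'a}) = 2 * card ((\<lambda>t::'a. t * t) ` (UNIV - {0}))"
  proof (rule card_two_to_one)
    fix x :: 'a assume x: "x \<in> UNIV - {0}"
    have "{y \<in> UNIV - {0}. y * y = x * x} = {x, - x}"
      using x by (auto simp: square_eq_iff)
    moreover have "x \<noteq> - x"
    proof
      assume "x = - x"
      then have "2 * x = 0" by (metis add.right_inverse mult_2)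
      then show False using x assms by simp
    qed
    ultimately show "card {y \<in> UNIV - {0}. y * y = x * x} = 2" by simp
  qed simp
  moreover have "CARD('a) = card (UNIV - {0::'a}) + 1"
    by (simp add: card_Diff_singleton card_gt_0_iff Suc_leI)
  ultimately show ?thesis by (simp only:)
qed

text \<open>By Fermat the M nonzero squares are roots of X^M - 1, and a polynomial of degree M has
  no room for further roots.\<close>

lemma euler_criterion:
  fixes v :: "'a::{field,finite}"
  assumes two: "(2::'a) \<noteq> 0" and q: "CARD('a) = 2 * M + 1" and v: "v \<noteq> 0"
  shows "(\<exists>t. t * t = v) \<longleftrightarrow> v ^ M = 1"
proof -
  let ?Q = "(\<lambda>t::'a. t * t) ` (UNIV - {0})"
  have cardQ: "card ?Q = M" using card_odd_finite_field[OF two] q by simp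
  have M: "M > 0"
  proof (rule ccontr)
    assume "\<not> M > 0"
    then have "card {0, 1::'a} \<le> 1" using q card_mono[of UNIV "{0, 1::'a}"] by simp
    then show False by simp
  qed
  define p :: "'a poly" where "p = monom 1 M - 1"
  have p: "p \<noteq> 0" "degree p \<le> M"
  proof -
    have "coeff p M = 1" using M by (simp add: p_def coeff_1)
    then show "p \<noteq> 0" by auto
    show "degree p \<le> M" unfolding p_def by (intro degree_diff_le) (auto simp: degree_monom_eq)
  qed
  have roots: "{v. poly p v = 0} = {v. v ^ M = 1}" by (auto simp: p_def poly_monom)
  have "?Q \<subseteq> {v. v ^ M = 1}"
  proof
    fix y assume "y \<in> ?Q"
    then obtain t where t: "t \<noteq> 0" "y = t * t" by blast
    have "y ^ M = t ^ (CARD('a) - 1)" by (simp add: t(2) q power_mult_distrib power_add[symmetric] mult_2)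
    then show "y \<in> {v. v ^ M = 1}" using finite_field_fermat[OF t(1)] by simp
  qed
  moreover have "card {v::'a. v ^ M = 1} \<le> card ?Q"
    using card_poly_roots_bound[OF p(1)] p(2) roots cardQ by simp
  ultimately have "?Q = {v. v ^ M = 1}" by (intro card_seteq) auto
  then have "v ^ M = 1 \<longleftrightarrow> v \<in> ?Q" by simp
  also have "\<dots> \<longleftrightarrow> (\<exists>t. t * t = v)" using v by auto
  finally show ?thesis by blast
qed

text \<open>The value at 0 is 1 rather than the customary 0: the function is then always a sign and
  records exactly whether the formula holds. Multiplicativity is claimed only for nonzero
  arguments.\<close>

definition quadratic_char :: "'a::times \<Rightarrow> real" where
  "quadratic_char v = (if \<exists>t. t * t = v then 1 else -1)"

lemma quadratic_char_eq_1_iff: "quadratic_char v = 1 \<longleftrightarrow> (\<exists>t. t * t = v)"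
  by (simp add: quadratic_char_def)

lemma power_half_cases:
  fixes v :: "'a::{field,finite}"
  assumes "CARD('a) = 2 * M + 1" "v \<noteq> 0"
  shows "v ^ M = 1 \<or> v ^ M = -1"
proof -
  have "(v ^ M) * (v ^ M) = v ^ (CARD('a) - 1)"
    by (simp add: assms(1) power_add[symmetric] mult_2)
  then have "(v ^ M) * (v ^ M) = 1 * 1" using finite_field_fermat[OF assms(2)] by simp
  then show ?thesis unfolding square_eq_iff .
qed

lemma quadratic_char_mult:
  fixes u v :: "'a::{field,finite}"
  assumes two: "(2::'a) \<noteq> 0" and nz: "u \<noteq> 0" "v \<noteq> 0"
  shows "quadratic_char (u * v) = quadratic_char u * quadratic_char v"
proof -
  define M where "M = card ((\<lambda>t::'a. t * t) ` (UNIV - {0}))"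
  have q: "CARD('a) = 2 * M + 1" unfolding M_def by (rule card_odd_finite_field[OF two])
  have "quadratic_char w = (if w ^ M = 1 then 1 else -1)" if "w \<noteq> 0" for w :: 'a
    using euler_criterion[OF two q that] by (simp add: quadratic_char_def)
  then show ?thesis
    using nz power_half_cases[OF q nz(1)] power_half_cases[OF q nz(2)] minus_one_neq_one[OF two]
    by (auto simp: power_mult_distrib)
qed

lemma quadratic_char_prod:
  fixes f :: "'x \<Rightarrow> 'a::{field,finite}"
  assumes two: "(2::'a) \<noteq> 0" and nz: "\<And>x. x \<in> I \<Longrightarrow> f x \<noteq> 0"
  shows "quadratic_char (\<Prod>x\<in>I. f x) = (\<Prod>x\<in>I. quadratic_char (f x))"
  using nz
proof (induction I rule: infinite_finite_induct)
  case (insert x I)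
  then show ?case by (simp add: quadratic_char_mult[OF two])
qed (simp_all add: quadratic_char_eq_1_iff exI[of _ 1])

text \<open>Outside A the values 1 and -1 of f^M share all points. Stepanov's method caps both
  classes just above q/2, so neither can fall far below q/2, and upper bounds alone control the
  difference.\<close>

lemma quadratic_char_sum_bound:
  fixes A S :: "'a::{field,finite} set"
  assumes two: "(2::'a) \<noteq> 0" and S: "S \<noteq> {}" "S \<subseteq> A"
    and k: "k > 0" "12 * card A * k\<^sup>2 < CARD('a)"
  shows "\<bar>\<Sum>z\<in>UNIV - A. quadratic_char (\<Prod>x\<in>S. z - x)\<bar> * k \<le> 2 * card A * CARD('a)"
proof -
  define q where "q = CARD('a)"
  define M where "M = card ((\<lambda>t::'a. t * t) ` (UNIV - {0}))"
  have q: "CARD('a) = 2 * M + 1" unfolding M_def by (rule card_odd_finite_field[OF two])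
  define f where "f z = (\<Prod>x\<in>S. z - x)" for z
  have fnz: "f z \<noteq> 0" if "z \<in> UNIV - A" for z
    using that S(2) by (auto simp: f_def prod_zero_iff)
  have sn: "card S \<le> card A" using S(2) by (simp add: card_mono)
  have kS: "12 * card S * k\<^sup>2 < CARD('a)"
    using k(2) sn by (intro le_less_trans[OF mult_le_mono1[OF mult_le_mono2[OF sn]]])
  define N where "N a = card {z \<in> UNIV - A. f z ^ M = a}" for a
  have N: "2 * k * N a \<le> (k + card A) * q" if "a \<noteq> 0" for a
  proof -
    have "N a \<le> card {z. poly (root_poly S) z ^ M = a}"
      unfolding N_def f_def poly_root_poly by (intro card_mono) auto
    then have "2 * k * N a \<le> 2 * k * card {z. poly (root_poly S) z ^ M = a}" by simp
    also have "\<dots> \<le> (k + card S) * q"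
      unfolding q_def by (rule stepanov_bound[OF q S(1) that k(1) kS])
    also have "\<dots> \<le> (k + card A) * q" using sn by simp
    finally show ?thesis .
  qed
  have ne: "(-1::'a) \<noteq> 1" by (rule minus_one_neq_one[OF two])
  have split: "UNIV - A = {z \<in> UNIV - A. f z ^ M = 1} \<union> {z \<in> UNIV - A. f z ^ M = -1}"
    using power_half_cases[OF q fnz] by blast
  have disj: "{z \<in> UNIV - A. f z ^ M = 1} \<inter> {z \<in> UNIV - A. f z ^ M = -1} = {}"
    using ne by auto
  have tot: "q = N 1 + N (-1) + card A"
  proof -
    have "card (UNIV - A) = N 1 + N (-1)"
      unfolding N_def by (subst split) (rule card_Un_disjoint[OF _ _ disj], auto)
    moreover have "card A \<le> q" unfolding q_def by (rule card_mono) auto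
    ultimately show ?thesis by (simp add: card_Diff_subset q_def)
  qed
  have "(\<Sum>z\<in>UNIV - A. quadratic_char (f z)) = real (N 1) - real (N (-1))"
  proof -
    have chi: "quadratic_char (f z) = (if f z ^ M = 1 then 1 else -1)" if "z \<in> UNIV - A" for z
      using euler_criterion[OF two q fnz[OF that]] by (simp add: quadratic_char_def)
    have "(\<Sum>z\<in>UNIV - A. quadratic_char (f z)) =
      (\<Sum>z | z \<in> UNIV - A \<and> f z ^ M = 1. quadratic_char (f z)) +
      (\<Sum>z | z \<in> UNIV - A \<and> f z ^ M = -1. quadratic_char (f z))"
      by (subst split, subst sum.union_disjoint[OF _ _ disj]) auto
    also have "(\<Sum>z | z \<in> UNIV - A \<and> f z ^ M = 1. quadratic_char (f z)) = real (N 1)"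
      unfolding N_def by (subst sum.cong[OF refl, where h = "\<lambda>_. 1"]) (auto simp: chi)
    also have "(\<Sum>z | z \<in> UNIV - A \<and> f z ^ M = -1. quadratic_char (f z)) = - real (N (-1))"
      unfolding N_def by (subst sum.cong[OF refl, where h = "\<lambda>_. -1"]) (auto simp: chi ne)
    finally show ?thesis by simp
  qed
  moreover have "\<bar>real (N 1) - real (N (-1))\<bar> * k \<le> 2 * card A * q"
  proof -
    have "k \<le> q"
    proof -
      have "card A > 0" using S by (auto simp: card_gt_0_iff)
      then have "k \<le> 12 * card A * k\<^sup>2" using k(1) by (simp add: power2_eq_square)
      then show ?thesis using k(2) by (simp add: q_def)
    qed
    \<comment> \<open>Of the two copies of \<open>card A * q\<close> in the bound, one is the error
      of Stepanov's method and the other absorbs the points of A omitted from the sum.\<close>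
    then have kA: "card A * k \<le> card A * q" by simp
    have "k * q = k * N 1 + k * N (-1) + card A * k"
      by (subst tot) (simp add: algebra_simps)
    moreover have "2 * (k * N 1) \<le> k * q + card A * q" "2 * (k * N (-1)) \<le> k * q + card A * q"
      using N[of 1] N[of "-1"] by (simp_all add: algebra_simps)
    ultimately have "k * N 1 \<le> k * N (-1) + 2 * (card A * q)" "k * N (-1) \<le> k * N 1 + 2 * (card A * q)"
      using kA by linarith+
    then have "real (k * N 1) \<le> real (k * N (-1) + 2 * (card A * q))"
      "real (k * N (-1)) \<le> real (k * N 1 + 2 * (card A * q))"
      by (simp_all only: of_nat_le_iff)
    then show ?thesis by (auto simp: abs_if algebra_simps)
  qed
  ultimately show ?thesis by (simp add: f_def q_def)
qed

text \<open>Here k is the factor saved in each character sum. The first inequality admits Stepanov's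
  method; the second lets the saving, raised to the power m, beat the 2^n subsets. The sums are at
  most 2nq/k, and 4n in place of 2n pays for replacing q by q - n.\<close>

definition large_field :: "nat \<Rightarrow> nat \<Rightarrow> nat \<Rightarrow> bool" where
  "large_field m n q \<longleftrightarrow> (\<exists>k>0. 12 * n * k\<^sup>2 < q \<and> 2 ^ n * (4 * n) ^ m < k ^ m)"

lemma subset_coded_by_squares:
  fixes A :: "'a::{field,finite} set"
  assumes two: "(2::'a) \<noteq> 0" and large: "large_field m (card A) CARD('a)"
  shows "\<exists>z. \<forall>x\<in>A. (\<exists>t. t * t = (\<Prod>j<m. z j - x)) \<longleftrightarrow> x \<in> E"
proof (cases "A = {}")
  case False
  define n q where "n = card A" and "q = CARD('a)"
  obtain k where k: "k > 0" "12 * n * k\<^sup>2 < q" "2 ^ n * (4 * n) ^ m < k ^ m"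
    using large unfolding large_field_def n_def q_def by blast
  \<comment> \<open>The z_j stay outside A, so that no factor z_j - x is zero and the character is
    multiplicative throughout.\<close>
  define P where "P = {..<m} \<rightarrow>\<^sub>E (UNIV - A)"
  define \<psi> where "\<psi> z x = quadratic_char (\<Prod>j<m. z j - x)" for z :: "nat \<Rightarrow> 'a" and x
  have n: "n > 0" using False by (simp add: n_def card_gt_0_iff)
  have "n \<le> n * k\<^sup>2" using k(1) by simp
  then have nq: "2 * n \<le> q" using k(2) by linarith
  have cardUA: "card (UNIV - A) = q - n" by (simp add: card_Diff_subset n_def q_def)
  have "\<exists>z\<in>P. \<forall>x\<in>A. \<psi> z x = 1 \<longleftrightarrow> x \<in> E"
  proof (rule sign_pattern_exists)
    show "finite P" by (simp add: P_def finite_PiE)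
    show "\<psi> c x = 1 \<or> \<psi> c x = -1" for c x by (simp add: \<psi>_def quadratic_char_def)
    have T: "\<bar>\<Sum>z\<in>P. \<Prod>x\<in>S. \<psi> z x\<bar> \<le> (2 * n * q / k) ^ m" if S: "S \<in> Pow A - {{}}" for S
    proof -
      define \<sigma> where "\<sigma> = (\<Sum>z\<in>UNIV - A. quadratic_char (\<Prod>x\<in>S. z - x))"
      have "(\<Prod>x\<in>S. \<psi> z x) = (\<Prod>j<m. quadratic_char (\<Prod>x\<in>S. z j - x))" if z: "z \<in> P" for z
      proof -
        have nz: "z j - x \<noteq> 0" if "j < m" "x \<in> S" for j x
          using z that S unfolding P_def by (auto simp: PiE_iff)
        have "(\<Prod>x\<in>S. \<psi> z x) = (\<Prod>x\<in>S. \<Prod>j<m. quadratic_char (z j - x))"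
          unfolding \<psi>_def using nz by (intro prod.cong refl quadratic_char_prod[OF two]) auto
        also have "\<dots> = (\<Prod>j<m. \<Prod>x\<in>S. quadratic_char (z j - x))" by (rule prod.swap)
        also have "\<dots> = (\<Prod>j<m. quadratic_char (\<Prod>x\<in>S. z j - x))"
          using nz by (intro prod.cong refl quadratic_char_prod[OF two, symmetric]) auto
        finally show ?thesis .
      qed
      then have "(\<Sum>z\<in>P. \<Prod>x\<in>S. \<psi> z x) =
          (\<Sum>z\<in>P. \<Prod>j<m. quadratic_char (\<Prod>x\<in>S. z j - x))" by simp
      also have "\<dots> = (\<Prod>j<m. \<Sum>z\<in>UNIV - A. quadratic_char (\<Prod>x\<in>S. z - x))"
        unfolding P_def by (rule prod_sum_PiE[symmetric]) auto
      also have "\<dots> = \<sigma> ^ m" by (simp add: \<sigma>_def)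
      finally have eq: "\<bar>\<Sum>z\<in>P. \<Prod>x\<in>S. \<psi> z x\<bar> = \<bar>\<sigma>\<bar> ^ m" by (simp add: power_abs)
      have "\<bar>\<sigma>\<bar> * k \<le> 2 * n * q"
        unfolding \<sigma>_def n_def q_def
        using S k(1,2) by (intro quadratic_char_sum_bound[OF two]) (auto simp: n_def q_def)
      then have "\<bar>\<sigma>\<bar> \<le> 2 * n * q / k" using k(1) by (simp add: field_simps)
      then show ?thesis unfolding eq by (intro power_mono) auto
    qed
    have "(\<Sum>S\<in>Pow A - {{}}. \<bar>\<Sum>z\<in>P. \<Prod>x\<in>S. \<psi> z x\<bar>) \<le> (\<Sum>S\<in>Pow A - {{}}. (2 * n * q / k) ^ m)"
      by (intro sum_mono T)
    also have "\<dots> \<le> 2 ^ n * (2 * n * q / k) ^ m"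
    proof -
      have "card (Pow A - {{}}) \<le> 2 ^ n"
        using card_mono[of "Pow A" "Pow A - {{}}"] by (simp add: card_Pow n_def)
      then have "real (card (Pow A - {{}})) \<le> real (2 ^ n)" by (simp only: of_nat_le_iff)
      then show ?thesis by (simp add: mult_right_mono)
    qed
    \<comment> \<open>Rewritten in terms of q - n, since \<open>P\<close> has (q - n)^m
      elements.\<close>
    also have "\<dots> \<le> 2 ^ n * (4 * n * real (q - n) / k) ^ m"
    proof (intro mult_left_mono power_mono divide_right_mono)
      have "real q \<le> 2 * real (q - n)" using nq by linarith
      then have "2 * real n * real q \<le> 2 * real n * (2 * real (q - n))" by (intro mult_left_mono) auto
      then show "real (2 * n * q) \<le> real (4 * n) * real (q - n)" by simp
    qed auto
    also have "\<dots> = (2 ^ n * (4 * n) ^ m) * real (q - n) ^ m / k ^ m"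
      by (simp add: power_divide power_mult_distrib)
    also have "\<dots> < k ^ m * real (q - n) ^ m / k ^ m"
    proof -
      have "real (2 ^ n * (4 * n) ^ m) < real (k ^ m)" using k(3) by (simp only: of_nat_less_iff)
      moreover have "real (q - n) ^ m > 0" using nq n by simp
      ultimately show ?thesis using k(1) by (intro divide_strict_right_mono mult_strict_right_mono) auto
    qed
    also have "\<dots> = real (card P)" using k(1) by (simp add: P_def card_PiE cardUA)
    finally show "(\<Sum>S\<in>Pow A - {{}}. \<bar>\<Sum>z\<in>P. \<Prod>x\<in>S. \<psi> z x\<bar>) < real (card P)" .
  qed simp
  then show ?thesis unfolding \<psi>_def quadratic_char_eq_1_iff by blast
qed simp

section \<open>Characteristic two: the Artin--Schreier character\<close>

text \<open>On a finite field of characteristic two this is (-1)^Tr(v), with the trace to the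
  two-element field, by the additive form of Hilbert 90. The description by t^2 + t can be stated by
  a fixed formula.\<close>

definition artin_schreier_char :: "'a::semiring \<Rightarrow> real" where
  "artin_schreier_char v = (if \<exists>t. t * t + t = v then 1 else -1)"

lemma artin_schreier_char_eq_1_iff: "artin_schreier_char v = 1 \<longleftrightarrow> (\<exists>t. t * t + t = v)"
  by (simp add: artin_schreier_char_def)

context
  assumes two: "(2::'a::{field,finite}) = 0"
begin

lemma char_two_add_self: "x + x = (0::'a)"
  by (metis mult_2 mult_zero_left two)

lemma char_two_eq_iff: "x = y \<longleftrightarrow> x + y = (0::'a)"
proof
  assume "x + y = 0"
  then have "x + (y + y) = y" by (simp only: add.assoc[symmetric] add_0_left)
  then show "x = y" by (simp only: char_two_add_self add_0_right)
qed (simp only: char_two_add_self)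

lemma char_two_square_add: "(s + t) * (s + t) = s * s + t * (t::'a)"
proof -
  have "(s + t) * (s + t) = s * s + t * t + (s * t + s * t)"
    by (simp only: distrib_left distrib_right ac_simps)
  then show ?thesis by (simp only: char_two_add_self add_0_right)
qed

lemma card_artin_schreier_image: "CARD('a) = 2 * card (range (\<lambda>t::'a. t * t + t))"
proof (rule card_two_to_one)
  fix x :: 'a
  have "y * y + y = x * x + x \<longleftrightarrow> y = x \<or> y = x + 1" for y
  proof -
    have "y * y + y = x * x + x \<longleftrightarrow> (y * y + y) + (x * x + x) = 0"
      by (rule char_two_eq_iff)
    also have "(y * y + y) + (x * x + x) = (y + x) * (y + x) + (y + x)"
      unfolding char_two_square_add by (simp only: ac_simps)
    also have "\<dots> = (y + x) * (y + (x + 1))" by (simp add: algebra_simps)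
    also have "\<dots> = 0 \<longleftrightarrow> y = x \<or> y = x + 1"
      by (simp only: mult_eq_0_iff char_two_eq_iff[of y])
    finally show ?thesis .
  qed
  then have "{y \<in> UNIV. y * y + y = x * x + x} = {x, x + 1}" by auto
  then show "card {y \<in> UNIV. y * y + y = x * x + x} = 2" by simp
qed simp

text \<open>The image H of t^2 + t is an additive subgroup with half of the elements. For u outside
  H the sets H and u + H therefore fill the field, and the sum of two elements outside H lies in
  H.\<close>

lemma artin_schreier_char_add:
  "artin_schreier_char (u + v) = artin_schreier_char u * artin_schreier_char (v::'a)"
proof -
  define H where "H = range (\<lambda>t::'a. t * t + t)"
  have add: "u + v \<in> H" if uv: "u \<in> H" "v \<in> H" for u v
  proof -
    obtain s t where "u = s * s + s" "v = t * t + t" using uv unfolding H_def by blast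
    then have "u + v = (s + t) * (s + t) + (s + t)"
      unfolding char_two_square_add by (simp only: ac_simps)
    then show ?thesis unfolding H_def by blast
  qed
  have cancel: "u + (u + v) = v" for u v :: 'a
    by (simp only: add.assoc[symmetric] char_two_add_self add_0_left)
  have sub: "v \<in> H" if uv: "u \<in> H" "u + v \<in> H" for u v
    using add[OF uv] by (simp only: cancel)
  have sub': "u \<in> H" if uv: "v \<in> H" "u + v \<in> H" for u v
    using sub[of v u] uv by (simp only: add.commute[of v u])
  have out: "u + v \<in> H" if uv: "u \<notin> H" "v \<notin> H" for u v
  proof -
    have "card ((\<lambda>h. u + h) ` H) = card H" by (intro card_image) (simp add: inj_on_def)
    moreover have "H \<inter> (\<lambda>h. u + h) ` H = {}"
      using sub' uv(1) by blast
    ultimately have "card (H \<union> (\<lambda>h. u + h) ` H) = 2 * card H"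
      by (simp add: card_Un_disjoint)
    also have "\<dots> = CARD('a)" unfolding H_def by (rule card_artin_schreier_image[symmetric])
    finally have "H \<union> (\<lambda>h. u + h) ` H = UNIV" by (intro card_subset_eq) simp_all
    then have "v \<in> (\<lambda>h. u + h) ` H" using uv(2) by blast
    then obtain h where "h \<in> H" "v = u + h" by blast
    then show ?thesis by (simp only: cancel)
  qed
  have char: "artin_schreier_char w = (if w \<in> H then 1 else -1)" for w
  proof -
    have "w \<in> H \<longleftrightarrow> (\<exists>t. t * t + t = w)" unfolding H_def by blast
    then show ?thesis by (simp add: artin_schreier_char_def)
  qed
  have "u + v \<in> H \<longleftrightarrow> (u \<in> H \<longleftrightarrow> v \<in> H)"
  proof (cases "u \<in> H")
    case True
    then show ?thesis using add sub by blast
  next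
    case False
    then show ?thesis using sub' out by blast
  qed
  then show ?thesis unfolding char by simp
qed

lemma artin_schreier_char_sum:
  "artin_schreier_char (\<Sum>x\<in>I. f x :: 'a) = (\<Prod>x\<in>I. artin_schreier_char (f x))"
proof (induction I rule: infinite_finite_induct)
  case (insert x I)
  then show ?case by (simp add: artin_schreier_char_add)
qed (simp_all add: artin_schreier_char_eq_1_iff exI[of _ 0])

lemma sum_artin_schreier_char:
  assumes "w \<noteq> (0::'a)"
  shows "(\<Sum>c\<in>UNIV. artin_schreier_char (c * w)) = 0"
proof -
  let ?H = "range (\<lambda>t::'a. t * t + t)"
  have "bij_betw (\<lambda>c. c * w) UNIV UNIV"
    by (rule bij_betwI[where g = "\<lambda>c. c / w"]) (use assms in auto)
  then have "(\<Sum>c\<in>UNIV. artin_schreier_char (c * w)) = (\<Sum>v::'a\<in>UNIV. artin_schreier_char v)"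
    by (rule sum.reindex_bij_betw)
  also have "\<dots> = (\<Sum>v\<in>UNIV - ?H. artin_schreier_char v) + (\<Sum>v\<in>?H. artin_schreier_char v)"
    by (rule sum.subset_diff) auto
  also have "(\<Sum>v\<in>?H. artin_schreier_char v) = (\<Sum>v\<in>?H. 1)"
    by (intro sum.cong refl) (auto simp: artin_schreier_char_def)
  also have "(\<Sum>v\<in>UNIV - ?H. artin_schreier_char v) = (\<Sum>v\<in>UNIV - ?H. -1)"
    by (intro sum.cong refl) (auto simp: artin_schreier_char_def)
  finally show ?thesis
    using card_artin_schreier_image by (simp add: card_Diff_subset)
qed

section \<open>Poles that separate the subsets\<close>

text \<open>Clearing denominators leaves p, the derivative of the product of X - x over S, of degree
  below |S|. Derivatives may vanish identically in characteristic two, but at a point of S exactly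
  one summand of p is nonzero.\<close>

lemma card_zeros_sum_inverse:
  fixes A S :: "'a set"
  assumes "S \<noteq> {}" "S \<subseteq> A"
  shows "card {z \<in> UNIV - A. (\<Sum>x\<in>S. 1 / (z - x)) = 0} \<le> card A"
proof -
  define p where "p = (\<Sum>x\<in>S. root_poly (S - {x}))"
  obtain a where a: "a \<in> S" using assms(1) by blast
  have "poly (root_poly (S - {x})) a = 0" if "x \<in> S - {a}" for x
    using that a by (auto simp: poly_root_poly prod_zero_iff)
  then have "poly p a = poly (root_poly (S - {a})) a"
    unfolding p_def poly_sum using a by (subst sum.remove[of _ a]) auto
  also have "\<dots> \<noteq> 0" by (auto simp: poly_root_poly prod_zero_iff)
  finally have p: "p \<noteq> 0" by auto
  have "degree p \<le> card A"
    unfolding p_def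
  proof (rule degree_sum_le)
    fix x assume "x \<in> S"
    have "card (S - {x}) \<le> card A" using assms(2) by (intro card_mono) auto
    then show "degree (root_poly (S - {x})) \<le> card A" by (simp add: degree_root_poly)
  qed simp
  have "{z \<in> UNIV - A. (\<Sum>x\<in>S. 1 / (z - x)) = 0} \<subseteq> {z. poly p z = 0}"
  proof clarify
    fix z assume z: "z \<notin> A" "(\<Sum>x\<in>S. 1 / (z - x)) = 0"
    have "poly (root_poly (S - {x})) z = poly (root_poly S) z * (1 / (z - x))" if "x \<in> S" for x
    proof -
      have "poly (root_poly S) z = (z - x) * poly (root_poly (S - {x})) z"
        unfolding poly_root_poly using that by (simp add: prod.remove)
      moreover have "z - x \<noteq> 0" using z(1) that assms(2) by auto
      ultimately show ?thesis by simp
    qed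
    then have "poly p z = poly (root_poly S) z * (\<Sum>x\<in>S. 1 / (z - x))"
      unfolding p_def poly_sum sum_distrib_left by (intro sum.cong refl) auto
    then show "poly p z = 0" using z(2) by simp
  qed
  then have "card {z \<in> UNIV - A. (\<Sum>x\<in>S. 1 / (z - x)) = 0} \<le> card {z. poly p z = 0}"
    by (intro card_mono) auto
  also have "\<dots> \<le> degree p" by (rule card_poly_roots_bound[OF p])
  finally show ?thesis using \<open>degree p \<le> card A\<close> by linarith
qed

text \<open>The second conclusion says that the vectors (1 / (z_j - x))_j for x in A are linearly
  independent over the two-element field. Each nonempty S spoils at most |A|^m of the (q - |A|)^m
  tuples.\<close>

lemma separating_poles_exist:
  fixes A :: "'a set"
  assumes "2 ^ card A * card A ^ m < (CARD('a) - card A) ^ m"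
  obtains z where "\<And>j. j < m \<Longrightarrow> z j \<notin> A"
    "\<And>S. S \<noteq> {} \<Longrightarrow> S \<subseteq> A \<Longrightarrow> \<exists>j<m. (\<Sum>x\<in>S. 1 / (z j - x)) \<noteq> 0"
proof -
  define Z where "Z S = {z \<in> UNIV - A. (\<Sum>x\<in>S. 1 / (z - x)) = 0}" for S
  define bad where "bad = (\<Union>S\<in>Pow A - {{}}. {..<m} \<rightarrow>\<^sub>E Z S)"
  have "card bad \<le> (\<Sum>S\<in>Pow A - {{}}. card ({..<m} \<rightarrow>\<^sub>E Z S))"
    unfolding bad_def by (rule card_UN_le) simp
  also have "\<dots> \<le> (\<Sum>S\<in>Pow A - {{}}. card A ^ m)"
  proof (rule sum_mono)
    fix S assume "S \<in> Pow A - {{}}"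
    then have "card (Z S) \<le> card A" unfolding Z_def by (intro card_zeros_sum_inverse) auto
    then show "card ({..<m} \<rightarrow>\<^sub>E Z S) \<le> card A ^ m" by (simp add: card_PiE power_mono)
  qed
  also have "\<dots> \<le> 2 ^ card A * card A ^ m"
    using card_mono[of "Pow A" "Pow A - {{}}"] by (simp add: card_Pow)
  also have "\<dots> < card ({..<m} \<rightarrow>\<^sub>E (UNIV - A))"
    using assms by (simp add: card_PiE card_Diff_subset)
  finally have "card bad < card ({..<m} \<rightarrow>\<^sub>E (UNIV - A))" .
  moreover have "finite bad" unfolding bad_def by (intro finite_UN_I finite_PiE) auto
  ultimately have "\<not> ({..<m} \<rightarrow>\<^sub>E (UNIV - A)) \<subseteq> bad" by (meson card_mono not_le)
  then obtain z where z: "z \<in> {..<m} \<rightarrow>\<^sub>E (UNIV - A)" "z \<notin> bad" by blast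
  show thesis
  proof
    show "z j \<notin> A" if "j < m" for j using z(1) that by (auto simp: PiE_iff)
    show "\<exists>j<m. (\<Sum>x\<in>S. 1 / (z j - x)) \<noteq> 0" if S: "S \<noteq> {}" "S \<subseteq> A" for S
    proof (rule ccontr)
      assume "\<not> ?thesis"
      then have "z \<in> {..<m} \<rightarrow>\<^sub>E Z S" using z(1) by (auto simp: PiE_iff Z_def)
      then show False using z(2) S unfolding bad_def by blast
    qed
  qed
qed

text \<open>For fixed poles each sum over the coefficients c factors over j, and a factor with
  \<open>w j\<close> nonzero is zero by orthogonality. The sums in the sign criterion are thus zero
  rather than merely small.\<close>

lemma subset_coded_by_artin_schreier:
  fixes A :: "'a set"
  assumes large: "large_field m (card A) CARD('a)"
  shows "\<exists>z c. (\<forall>j<m. z j \<notin> A) \<and>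
    (\<forall>x\<in>A. (\<exists>t. t * t + t = (\<Sum>j<m. c j / (z j - x))) \<longleftrightarrow> x \<in> E)"
proof (cases "A = {}")
  case False
  define n q where "n = card A" and "q = CARD('a)"
  obtain k where k: "k > 0" "12 * n * k\<^sup>2 < q" "2 ^ n * (4 * n) ^ m < k ^ m"
    using large unfolding large_field_def n_def q_def by blast
  have n: "n > 0" using False by (simp add: n_def card_gt_0_iff)
  have "n \<le> n * k\<^sup>2" "k\<^sup>2 \<le> n * k\<^sup>2" "k \<le> k\<^sup>2" using k(1) n by (simp_all add: power2_eq_square)
  then have nq: "k \<le> q - n" using k(2) by linarith
  \<comment> \<open>The inequality in \<open>large_field\<close> yields the one for the union bound,
    since n is at most 4n and k is at most q - n.\<close>
  have "2 ^ n * n ^ m \<le> 2 ^ n * (4 * n) ^ m" by (intro mult_left_mono power_mono) auto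
  also have "\<dots> < k ^ m" by (rule k(3))
  also have "\<dots> \<le> (q - n) ^ m" using nq by (intro power_mono) auto
  finally obtain z where z: "\<And>j. j < m \<Longrightarrow> z j \<notin> A"
    "\<And>S. S \<noteq> {} \<Longrightarrow> S \<subseteq> A \<Longrightarrow> \<exists>j<m. (\<Sum>x\<in>S. 1 / (z j - x)) \<noteq> 0"
    using separating_poles_exist[of A m] unfolding n_def q_def by blast
  define P :: "(nat \<Rightarrow> 'a) set" where "P = {..<m} \<rightarrow>\<^sub>E UNIV"
  define \<psi> where "\<psi> c x = artin_schreier_char (\<Sum>j<m. c j / (z j - x))" for c x
  have "\<exists>c\<in>P. \<forall>x\<in>A. \<psi> c x = 1 \<longleftrightarrow> x \<in> E"
  proof (rule sign_pattern_exists)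
    show "finite P" by (simp add: P_def finite_PiE)
    show "\<psi> c x = 1 \<or> \<psi> c x = -1" for c x by (simp add: \<psi>_def artin_schreier_char_def)
    have "(\<Sum>c\<in>P. \<Prod>x\<in>S. \<psi> c x) = 0" if S: "S \<in> Pow A - {{}}" for S
    proof -
      define w where "w j = (\<Sum>x\<in>S. 1 / (z j - x))" for j
      have "(\<Prod>x\<in>S. \<psi> c x) = (\<Prod>j<m. artin_schreier_char (c j * w j))" for c
      proof -
        have "(\<Prod>x\<in>S. \<psi> c x) = artin_schreier_char (\<Sum>x\<in>S. \<Sum>j<m. c j / (z j - x))"
          unfolding \<psi>_def by (rule artin_schreier_char_sum[symmetric])
        also have "(\<Sum>x\<in>S. \<Sum>j<m. c j / (z j - x)) = (\<Sum>j<m. c j * w j)"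
          unfolding w_def sum_distrib_left by (subst sum.swap) simp
        finally show ?thesis by (simp add: artin_schreier_char_sum)
      qed
      then have "(\<Sum>c\<in>P. \<Prod>x\<in>S. \<psi> c x) = (\<Sum>c\<in>P. \<Prod>j<m. artin_schreier_char (c j * w j))" by simp
      also have "\<dots> = (\<Prod>j<m. \<Sum>c\<in>UNIV. artin_schreier_char (c * w j))"
        unfolding P_def by (rule prod_sum_PiE[symmetric]) auto
      also have "\<dots> = 0"
      proof -
        obtain j where "j < m" "w j \<noteq> 0" using z(2)[of S] S unfolding w_def by auto
        then show ?thesis using sum_artin_schreier_char by (auto simp: prod_zero_iff)
      qed
      finally show ?thesis .
    qed
    moreover have "card P > 0" by (simp add: P_def card_PiE)
    ultimately show "(\<Sum>S\<in>Pow A - {{}}. \<bar>\<Sum>c\<in>P. \<Prod>x\<in>S. \<psi> c x\<bar>) < real (card P)" by simp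
  qed simp
  then obtain c where "\<forall>x\<in>A. \<psi> c x = 1 \<longleftrightarrow> x \<in> E" by blast
  then have "\<forall>x\<in>A. (\<exists>t. t * t + t = (\<Sum>j<m. c j / (z j - x))) \<longleftrightarrow> x \<in> E"
    unfolding \<psi>_def artin_schreier_char_eq_1_iff .
  then show ?thesis using z(1) by blast
next
  case True
  then show ?thesis by simp
qed

end

section \<open>First-order formulas over a single ring\<close>

fun reval :: "('a, 'b) ring_scheme \<Rightarrow> (nat \<Rightarrow> 'a) \<Rightarrow> rtm \<Rightarrow> 'a" where
  "reval K \<rho> (Var n) = \<rho> n"
| "reval K \<rho> Zero = \<zero>\<^bsub>K\<^esub>"
| "reval K \<rho> One = \<one>\<^bsub>K\<^esub>"
| "reval K \<rho> (Add s t) = reval K \<rho> s \<oplus>\<^bsub>K\<^esub> reval K \<rho> t"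
| "reval K \<rho> (Mul s t) = reval K \<rho> s \<otimes>\<^bsub>K\<^esub> reval K \<rho> t"
| "reval K \<rho> (Neg s) = \<ominus>\<^bsub>K\<^esub> reval K \<rho> s"

fun rsat :: "('a, 'b) ring_scheme \<Rightarrow> 'a set \<Rightarrow> (nat \<Rightarrow> 'a) \<Rightarrow> rfm \<Rightarrow> bool" where
  "rsat K P \<rho> (Eq s t) \<longleftrightarrow> reval K \<rho> s = reval K \<rho> t"
| "rsat K P \<rho> (Pred t) \<longleftrightarrow> reval K \<rho> t \<in> P"
| "rsat K P \<rho> (Not \<phi>) \<longleftrightarrow> \<not> rsat K P \<rho> \<phi>"
| "rsat K P \<rho> (Conj \<phi> \<psi>) \<longleftrightarrow> rsat K P \<rho> \<phi> \<and> rsat K P \<rho> \<psi>"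
| "rsat K P \<rho> (Ex n \<phi>) \<longleftrightarrow> (\<exists>a\<in>carrier K. rsat K P (\<rho>(n := a)) \<phi>)"

lemma reval_closed:
  assumes "ring K" "\<And>n. \<rho> n \<in> carrier K"
  shows "reval K \<rho> t \<in> carrier K"
proof -
  interpret ring K by (rule assms(1))
  show ?thesis using assms(2) by (induction t) auto
qed

lemma reval_hom:
  assumes "cring K" "cring L" "h \<in> ring_hom K L" "\<And>n. \<rho> n \<in> carrier K"
  shows "h (reval K \<rho> t) = reval L (\<lambda>n. h (\<rho> n)) t"
proof -
  interpret ring_hom_cring K L h using assms(1-3)
    by (intro ring_hom_cring.intro ring_hom_cring_axioms.intro)
  note [simp] = reval_closed[OF R.ring_axioms assms(4)]
  show ?thesis by (induction t) simp_all
qed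

lemma rsat_iso:
  assumes ring: "cring K" "cring L" and h: "h \<in> ring_iso K L" and A: "A \<subseteq> carrier K"
    and \<rho>: "\<And>n. \<rho> n \<in> carrier K"
  shows "rsat K A \<rho> \<phi> \<longleftrightarrow> rsat L (h ` A) (\<lambda>n. h (\<rho> n)) \<phi>"
  using \<rho>
proof (induction \<phi> arbitrary: \<rho>)
  have hom: "h \<in> ring_hom K L" and bij: "bij_betw h (carrier K) (carrier L)"
    using h by (auto simp: ring_iso_def)
  then have inj: "inj_on h (carrier K)" and im: "h ` carrier K = carrier L"
    by (auto simp: bij_betw_def)
  {
    case (Eq s t)
    have "reval K \<rho> s \<in> carrier K" "reval K \<rho> t \<in> carrier K"
      using reval_closed[OF cring.axioms(1)[OF ring(1)], of \<rho>] Eq by auto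
    then show ?case
      using inj by (simp add: reval_hom[OF ring hom Eq, symmetric] inj_on_eq_iff)
  next
    case (Pred t)
    have "reval K \<rho> t \<in> carrier K" by (rule reval_closed[OF cring.axioms(1)[OF ring(1)] Pred])
    then show ?case
      using inj A by (simp add: reval_hom[OF ring hom Pred, symmetric] inj_on_image_mem_iff)
  next
    case (Not \<phi>)
    then show ?case by simp
  next
    case (Conj \<phi> \<psi>)
    then show ?case by simp
  next
    case (Ex n \<phi>)
    have "rsat K A (\<rho>(n := a)) \<phi> \<longleftrightarrow> rsat L (h ` A) ((\<lambda>k. h (\<rho> k))(n := h a)) \<phi>"
      if "a \<in> carrier K" for a
    proof -
      have "(\<lambda>k. h ((\<rho>(n := a)) k)) = (\<lambda>k. h (\<rho> k))(n := h a)" by auto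
      moreover have "rsat K A (\<rho>(n := a)) \<phi> \<longleftrightarrow> rsat L (h ` A) (\<lambda>k. h ((\<rho>(n := a)) k)) \<phi>"
        by (rule Ex.IH) (use Ex.prems that in simp)
      ultimately show ?thesis by (simp only:)
    qed
    then show ?case by (simp add: im[symmetric])
  }
qed

text \<open>Variable 0 holds the element and variable k + 1 the parameter \<open>c k\<close>, the
  assignment used for the ultraproduct as well.\<close>

definition codes_subsets :: "('a, 'b) ring_scheme \<Rightarrow> 'a set \<Rightarrow> rfm \<Rightarrow> bool" where
  "codes_subsets K A \<phi> \<longleftrightarrow> (\<forall>E\<subseteq>A. \<exists>c. (\<forall>k. c k \<in> carrier K) \<and>
     (\<forall>x\<in>A. rsat K A (case_nat x c) \<phi> \<longleftrightarrow> x \<in> E))"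

lemma codes_subsets_iso:
  assumes ring: "cring K" "cring L" and h: "h \<in> ring_iso K L" and A: "A \<subseteq> carrier K"
    and codes: "codes_subsets K A \<phi>"
  shows "codes_subsets L (h ` A) \<phi>"
  unfolding codes_subsets_def
proof (intro allI impI)
  fix E assume E: "E \<subseteq> h ` A"
  have bij: "bij_betw h (carrier K) (carrier L)" using h by (auto simp: ring_iso_def)
  define E' where "E' = {x \<in> A. h x \<in> E}"
  have "E' \<subseteq> A" by (auto simp: E'_def)
  then obtain c where c: "\<And>k. c k \<in> carrier K"
    "\<And>x. x \<in> A \<Longrightarrow> rsat K A (case_nat x c) \<phi> \<longleftrightarrow> x \<in> E'"
    using codes unfolding codes_subsets_def by meson
  show "\<exists>c. (\<forall>k. c k \<in> carrier L) \<and> (\<forall>x\<in>h ` A. rsat L (h ` A) (case_nat x c) \<phi> \<longleftrightarrow> x \<in> E)"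
  proof (intro exI[of _ "\<lambda>k. h (c k)"] conjI allI ballI)
    show "h (c k) \<in> carrier L" for k using bij c(1) by (auto simp: bij_betw_def)
    fix y assume "y \<in> h ` A"
    then obtain x where x: "x \<in> A" "y = h x" by blast
    have "(\<lambda>n. h (case_nat x c n)) = case_nat y (\<lambda>k. h (c k))"
      using x(2) by (auto simp: fun_eq_iff split: nat.split)
    moreover have "case_nat x c n \<in> carrier K" for n
      using c(1) x(1) A by (auto split: nat.split)
    ultimately have "rsat L (h ` A) (case_nat y (\<lambda>k. h (c k))) \<phi> \<longleftrightarrow> rsat K A (case_nat x c) \<phi>"
      using rsat_iso[OF ring h A, of "case_nat x c" \<phi>] by simp
    then show "rsat L (h ` A) (case_nat y (\<lambda>k. h (c k))) \<phi> \<longleftrightarrow> y \<in> E"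
      using c(2)[OF x(1)] x by (simp add: E'_def)
  qed
qed

section \<open>The coding formula\<close>

text \<open>Layout of the variables: 0 is x, 1 to m are the z_j, m + 1 to 2m the c_j, and 2m + 1 is
  the unknown t.\<close>

primrec den_tm :: "nat \<Rightarrow> rtm" where
  "den_tm 0 = One"
| "den_tm (Suc j) = Mul (den_tm j) (Add (Var (Suc j)) (Neg (Var 0)))"

text \<open>The numerator over the common denominator, as terms have no division: N/Q + c/(z - x)
  has numerator N (z - x) + c Q over Q (z - x).\<close>

primrec num_tm :: "nat \<Rightarrow> nat \<Rightarrow> rtm" where
  "num_tm m 0 = Zero"
| "num_tm m (Suc j) = Add (Mul (num_tm m j) (Add (Var (Suc j)) (Neg (Var 0))))
     (Mul (Var (Suc (m + j))) (den_tm j))"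

text \<open>In characteristic two, clearing denominators turns \<open>t\<^sup>2 + t = N / Q\<close> into
  \<open>t\<^sup>2 + t Q = N Q\<close> (replace \<open>t\<close> by \<open>t / Q\<close>).\<close>

definition coding_fm :: "bool \<Rightarrow> nat \<Rightarrow> rfm" where
  "coding_fm char2 m = (let t = Var (Suc (2 * m)) in Ex (Suc (2 * m))
     (if char2 then Eq (Add (Mul t t) (Mul t (den_tm m))) (Mul (num_tm m m) (den_tm m))
      else Eq (Mul t t) (den_tm m)))"

definition type_ring :: "'a::comm_ring_1 ring" where
  "type_ring = \<lparr>carrier = UNIV, mult = (*), one = 1, zero = 0, add = (+)\<rparr>"

lemma type_ring_simps [simp]:
  "carrier type_ring = UNIV" "x \<otimes>\<^bsub>type_ring\<^esub> y = x * y" "\<one>\<^bsub>type_ring\<^esub> = 1"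
  "\<zero>\<^bsub>type_ring\<^esub> = 0" "x \<oplus>\<^bsub>type_ring\<^esub> y = x + y"
  by (simp_all add: type_ring_def)

lemma cring_type_ring: "cring (type_ring :: 'a::comm_ring_1 ring)"
proof -
  have "\<exists>y. x + y = 0" for x :: 'a by (rule exI[of _ "- x"]) simp
  then show ?thesis
    by unfold_locales (auto simp: type_ring_def Units_def algebra_simps intro: exI[of _ "- _"])
qed

lemma a_inv_type_ring [simp]: "\<ominus>\<^bsub>type_ring\<^esub> x = - (x :: 'a::comm_ring_1)"
proof -
  interpret cring "type_ring :: 'a ring" by (rule cring_type_ring)
  show ?thesis by (rule minus_equality) auto
qed

lemma reval_den_tm: "reval type_ring \<rho> (den_tm j) = (\<Prod>i<j. \<rho> (Suc i) - \<rho> 0)"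
  by (induction j) simp_all

lemma reval_num_tm:
  fixes \<rho> :: "nat \<Rightarrow> 'a::field"
  assumes "\<And>i. i < j \<Longrightarrow> \<rho> (Suc i) \<noteq> \<rho> 0"
  shows "reval type_ring \<rho> (num_tm m j) =
    (\<Prod>i<j. \<rho> (Suc i) - \<rho> 0) * (\<Sum>i<j. \<rho> (Suc (m + i)) / (\<rho> (Suc i) - \<rho> 0))"
  using assms
proof (induction j)
  case (Suc j)
  have "\<rho> (Suc j) - \<rho> 0 \<noteq> 0" using Suc.prems[of j] by simp
  then show ?case using Suc by (simp add: reval_den_tm field_simps)
qed simp

lemma codes_subsets_type_ring:
  fixes A :: "'a::{field,finite} set"
  assumes "large_field m (card A) CARD('a)"
  shows "codes_subsets type_ring A (coding_fm ((2::'a) = 0) m)"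
  unfolding codes_subsets_def
proof (intro allI impI)
  fix E assume "E \<subseteq> A"
  show "\<exists>c. (\<forall>k. c k \<in> carrier type_ring) \<and>
      (\<forall>x\<in>A. rsat type_ring A (case_nat x c) (coding_fm ((2::'a) = 0) m) \<longleftrightarrow> x \<in> E)"
  proof (cases "(2::'a) = 0")
    case False
    obtain z :: "nat \<Rightarrow> 'a"
      where z: "\<And>x. x \<in> A \<Longrightarrow> (\<exists>t. t * t = (\<Prod>j<m. z j - x)) \<longleftrightarrow> x \<in> E"
      using subset_coded_by_squares[OF False assms, of E] by blast
    have "rsat type_ring A (case_nat x z) (coding_fm ((2::'a) = 0) m) \<longleftrightarrow>
        (\<exists>t. t * t = (\<Prod>j<m. z j - x))" for x
      using False by (simp add: coding_fm_def Let_def reval_den_tm)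
    then show ?thesis using z by (intro exI[of _ z]) simp
  next
    case True
    obtain z c :: "nat \<Rightarrow> 'a" where zA: "\<And>j. j < m \<Longrightarrow> z j \<notin> A"
      and zc: "\<And>x. x \<in> A \<Longrightarrow> (\<exists>t. t * t + t = (\<Sum>j<m. c j / (z j - x))) \<longleftrightarrow> x \<in> E"
      using subset_coded_by_artin_schreier[OF True assms, of E] by blast
    define d where "d k = (if k < m then z k else c (k - m))" for k
    have "rsat type_ring A (case_nat x d) (coding_fm ((2::'a) = 0) m) \<longleftrightarrow>
        (\<exists>t. t * t + t = (\<Sum>j<m. c j / (z j - x)))" if x: "x \<in> A" for x
    proof -
      define Q where "Q = (\<Prod>j<m. z j - x)"
      define W where "W = (\<Sum>j<m. c j / (z j - x))"
      have ne: "z j - x \<noteq> 0" if "j < m" for j using zA[OF that] x by auto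
      then have Q: "Q \<noteq> 0" by (simp add: Q_def)
      have den: "reval type_ring ((case_nat x d)(Suc (2 * m) := t)) (den_tm m) = Q" for t
        by (simp add: reval_den_tm Q_def d_def)
      have num: "reval type_ring ((case_nat x d)(Suc (2 * m) := t)) (num_tm m m) = Q * W" for t
        using ne by (subst reval_num_tm) (auto simp: Q_def W_def d_def)
      have "rsat type_ring A (case_nat x d) (coding_fm ((2::'a) = 0) m) \<longleftrightarrow>
          (\<exists>t. t * t + t * Q = Q * W * Q)"
        using True by (simp add: coding_fm_def Let_def den num)
      also have "\<dots> \<longleftrightarrow> (\<exists>t. t * t + t = W)"
      proof
        assume "\<exists>t. t * t + t * Q = Q * W * Q"
        then obtain t where "t * t + t * Q = Q * W * Q" by blast
        then have "(t / Q) * (t / Q) + t / Q = W" using Q by (simp add: field_simps)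
        then show "\<exists>t. t * t + t = W" by blast
      next
        assume "\<exists>t. t * t + t = W"
        then obtain t where "t * t + t = W" by blast
        then have "(t * Q) * (t * Q) + (t * Q) * Q = Q * W * Q" by (auto simp: algebra_simps)
        then show "\<exists>t. t * t + t * Q = Q * W * Q" by blast
      qed
      finally show ?thesis unfolding W_def .
    qed
    then show ?thesis using zc by (intro exI[of _ d]) simp
  qed
qed

section \<open>From type-class fields to field records\<close>

text \<open>All that is claimed of one finite field, gathered into an isomorphism invariant of K so
  that it can be carried from a type to a record.\<close>

definition has_coding :: "('a, 'b) ring_scheme \<Rightarrow> bool" where
  "has_coding K \<longleftrightarrow> (\<forall>m A. A \<subseteq> carrier K \<longrightarrow> large_field m (card A) (card (carrier K)) \<longrightarrow>
     codes_subsets K A (coding_fm (\<one>\<^bsub>K\<^esub> \<oplus>\<^bsub>K\<^esub> \<one>\<^bsub>K\<^esub> = \<zero>\<^bsub>K\<^esub>) m))"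

lemma has_coding_type_ring: "has_coding (type_ring :: 'a::{field,finite} ring)"
  unfolding has_coding_def using codes_subsets_type_ring[where 'a='a] by simp

lemma has_coding_iso:
  assumes ring: "cring K" "cring L" and h: "h \<in> ring_iso K L" and coding: "has_coding K"
  shows "has_coding L"
  unfolding has_coding_def
proof (intro allI impI)
  fix m A assume A: "A \<subseteq> carrier L" "large_field m (card A) (card (carrier L))"
  have bij: "bij_betw h (carrier K) (carrier L)" using h by (auto simp: ring_iso_def)
  interpret ring_hom_cring K L h
    using ring h
    by (intro ring_hom_cring.intro ring_hom_cring_axioms.intro) (auto simp: ring_iso_def)
  define B where "B = {x \<in> carrier K. h x \<in> A}"
  have B: "B \<subseteq> carrier K" "h ` B = A"
    using A(1) bij by (auto simp: B_def bij_betw_def)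
  have "card A = card B"
    using B bij by (metis bij_betw_def card_image inj_on_subset)
  moreover have "card (carrier L) = card (carrier K)" using bij_betw_same_card[OF bij] by simp
  moreover have "\<one>\<^bsub>L\<^esub> \<oplus>\<^bsub>L\<^esub> \<one>\<^bsub>L\<^esub> = \<zero>\<^bsub>L\<^esub> \<longleftrightarrow> \<one>\<^bsub>K\<^esub> \<oplus>\<^bsub>K\<^esub> \<one>\<^bsub>K\<^esub> = \<zero>\<^bsub>K\<^esub>"
  proof -
    have "h (\<one>\<^bsub>K\<^esub> \<oplus>\<^bsub>K\<^esub> \<one>\<^bsub>K\<^esub>) = h \<zero>\<^bsub>K\<^esub> \<longleftrightarrow> \<one>\<^bsub>K\<^esub> \<oplus>\<^bsub>K\<^esub> \<one>\<^bsub>K\<^esub> = \<zero>\<^bsub>K\<^esub>"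
      using bij by (intro inj_on_eq_iff) (auto simp: bij_betw_def)
    then show ?thesis by simp
  qed
  ultimately show "codes_subsets L A (coding_fm (\<one>\<^bsub>L\<^esub> \<oplus>\<^bsub>L\<^esub> \<one>\<^bsub>L\<^esub> = \<zero>\<^bsub>L\<^esub>) m)"
    using codes_subsets_iso[OF ring h B(1)] coding A(2) B unfolding has_coding_def by simp
qed

text \<open>A type cannot depend on the field at hand. Instead, one finite field on the naturals is
  fixed globally, chosen to be a counterexample to \<^const>\<open>has_coding\<close> if there is any; turning
  its carrier into a type shows that there is none.\<close>

definition critical_field :: "nat ring" where
  "critical_field = (SOME K. field K \<and> finite (carrier K) \<and>
     ((\<exists>L :: nat ring. field L \<and> finite (carrier L) \<and> \<not> has_coding L) \<longrightarrow> \<not> has_coding K))"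

text \<open>Ensures that \<open>critical_field\<close> is a finite field even when
  \<open>has_coding\<close> has no counterexample. The witness is the two-element field,
  renamed.\<close>

lemma exists_finite_field_nat: "\<exists>K :: nat ring. field K \<and> finite (carrier K)"
proof -
  have "field (type_ring :: bit ring)"
  proof (rule cring.cring_fieldI2[OF cring_type_ring])
    show "\<exists>b\<in>carrier type_ring. a \<otimes>\<^bsub>type_ring\<^esub> b = \<one>\<^bsub>type_ring\<^esub>"
      if "a \<in> carrier type_ring" "a \<noteq> \<zero>\<^bsub>type_ring\<^esub>" for a :: bit
      using that by (auto intro!: exI[of _ a])
  qed simp
  moreover have inj: "inj_on (\<lambda>b::bit. if b = 0 then 0 else 1 :: nat) (carrier type_ring)"
    by (auto simp: inj_on_def split: if_splits)
  ultimately have "field (image_ring (\<lambda>b::bit. if b = 0 then 0 else 1 :: nat) type_ring)"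
    by (rule field.inj_imp_image_ring_is_field)
  moreover have "finite (carrier (image_ring (\<lambda>b::bit. if b = 0 then 0 else 1 :: nat) type_ring))"
    unfolding image_ring_carrier by (rule finite_subset[of _ "{0, 1}"]) auto
  ultimately show ?thesis by blast
qed

lemma critical_field:
  "field critical_field" "finite (carrier critical_field)"
  "field L \<Longrightarrow> finite (carrier L) \<Longrightarrow> \<not> has_coding (L :: nat ring) \<Longrightarrow> \<not> has_coding critical_field"
proof -
  have "\<exists>K :: nat ring. field K \<and> finite (carrier K) \<and>
     ((\<exists>L :: nat ring. field L \<and> finite (carrier L) \<and> \<not> has_coding L) \<longrightarrow> \<not> has_coding K)"
    using exists_finite_field_nat by blast
  from someI_ex[OF this, folded critical_field_def]
  show "field critical_field" "finite (carrier critical_field)"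
    "field L \<Longrightarrow> finite (carrier L) \<Longrightarrow> \<not> has_coding (L :: nat ring) \<Longrightarrow> \<not> has_coding critical_field"
    by blast+
qed

typedef critical = "carrier critical_field"
proof -
  interpret field critical_field by (rule critical_field(1))
  show ?thesis using zero_closed by blast
qed

instance critical :: finite
proof
  have "(UNIV :: critical set) = Abs_critical ` carrier critical_field"
    by (metis type_definition.Abs_image type_definition_critical)
  then show "finite (UNIV :: critical set)" by (metis critical_field(2) finite_imageI)
qed

instantiation critical :: field
begin

definition "0 = Abs_critical \<zero>\<^bsub>critical_field\<^esub>"
definition "1 = Abs_critical \<one>\<^bsub>critical_field\<^esub>"
definition "x + y = Abs_critical (Rep_critical x \<oplus>\<^bsub>critical_field\<^esub> Rep_critical y)"
definition "x * y = Abs_critical (Rep_critical x \<otimes>\<^bsub>critical_field\<^esub> Rep_critical y)"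
definition "- x = Abs_critical (\<ominus>\<^bsub>critical_field\<^esub> Rep_critical x)"
definition "x - y = x + - (y :: critical)"
definition "inverse x = (if x = 0 then 0
  else Abs_critical (inv\<^bsub>critical_field\<^esub> Rep_critical x))"
definition "divide x y = x * inverse (y :: critical)"

instance
proof -
  interpret F: field critical_field by (rule critical_field(1))
  note closed = Rep_critical
  have rep: "Rep_critical 0 = \<zero>\<^bsub>critical_field\<^esub>" "Rep_critical 1 = \<one>\<^bsub>critical_field\<^esub>"
    "Rep_critical (x + y) = Rep_critical x \<oplus>\<^bsub>critical_field\<^esub> Rep_critical y"
    "Rep_critical (x * y) = Rep_critical x \<otimes>\<^bsub>critical_field\<^esub> Rep_critical y"
    "Rep_critical (- x) = \<ominus>\<^bsub>critical_field\<^esub> Rep_critical x" for x y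
    by (simp_all add: zero_critical_def one_critical_def plus_critical_def times_critical_def
        uminus_critical_def Abs_critical_inverse closed)
  show "OFCLASS(critical, field_class)"
  proof
    fix a b c :: critical
    show "a + b + c = a + (b + c)" "a * b * c = a * (b * c)" "(a + b) * c = a * c + b * c"
      by (simp_all add: Rep_critical_inject[symmetric] rep closed F.a_assoc F.m_assoc F.l_distr)
    show "a + b = b + a" "a * b = b * a"
      by (simp_all add: Rep_critical_inject[symmetric] rep closed F.a_comm F.m_comm)
    show "0 + a = a" "1 * a = a" "- a + a = 0"
      by (simp_all add: Rep_critical_inject[symmetric] rep closed F.l_neg)
    show "a - b = a + - b" "divide a b = a * inverse b" "inverse 0 = (0 :: critical)"
      by (simp_all add: minus_critical_def divide_critical_def inverse_critical_def)
    show "(0 :: critical) \<noteq> 1"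
      by (simp add: Rep_critical_inject[symmetric] rep)
    show "inverse a * a = 1" if "a \<noteq> 0"
    proof -
      have "Rep_critical a \<noteq> \<zero>\<^bsub>critical_field\<^esub>"
        using that by (simp add: Rep_critical_inject[symmetric] rep)
      then have "Rep_critical a \<in> Units critical_field"
        using closed F.field_Units by blast
      then show ?thesis
        using that by (simp add: Rep_critical_inject[symmetric] rep inverse_critical_def
            Abs_critical_inverse)
    qed
  qed
qed

end

lemma Rep_critical_iso: "Rep_critical \<in> ring_iso type_ring critical_field"
proof (rule ring_iso_memI)
  interpret F: field critical_field by (rule critical_field(1))
  show "Rep_critical x \<in> carrier critical_field" for x by (rule Rep_critical)
  show "Rep_critical (x \<otimes>\<^bsub>type_ring\<^esub> y) = Rep_critical x \<otimes>\<^bsub>critical_field\<^esub> Rep_critical y" for x y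
    by (simp add: times_critical_def Abs_critical_inverse Rep_critical)
  show "Rep_critical (x \<oplus>\<^bsub>type_ring\<^esub> y) = Rep_critical x \<oplus>\<^bsub>critical_field\<^esub> Rep_critical y" for x y
    by (simp add: plus_critical_def Abs_critical_inverse Rep_critical)
  show "Rep_critical \<one>\<^bsub>type_ring\<^esub> = \<one>\<^bsub>critical_field\<^esub>"
    by (simp add: one_critical_def Abs_critical_inverse)
  show "bij_betw Rep_critical (carrier type_ring) (carrier critical_field)"
    using type_definition.Rep_range[OF type_definition_critical]
    by (simp add: bij_betw_def inj_on_def Rep_critical_inject)
qed

text \<open>A finite carrier embeds in the naturals, so K has an isomorphic copy among the fields
  from which \<open>critical_field\<close> was chosen.\<close>

lemma has_coding_finite_field:
  fixes K :: "('a, 'b) ring_scheme"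
  assumes "field K" "finite (carrier K)"
  shows "has_coding K"
proof -
  have cring: "cring L" if "field L" for L :: "nat ring"
    using that by (meson domain.axioms(1) field.axioms(1))
  have "has_coding critical_field"
    using has_coding_iso[OF cring_type_ring cring Rep_critical_iso has_coding_type_ring]
      critical_field(1) by blast
  then have nat: "has_coding L" if "field L" "finite (carrier L)" for L :: "nat ring"
    using critical_field(3) that by blast
  interpret K: field K by (rule assms(1))
  obtain f :: "'a \<Rightarrow> nat" where f: "inj_on f (carrier K)"
    using finite_imp_inj_to_nat_seg[OF assms(2)] by blast
  have L: "field (image_ring f K)" by (rule K.inj_imp_image_ring_is_field[OF f])
  have "has_coding (image_ring f K)"
    using nat[OF L] assms(2) by (simp add: image_ring_carrier)
  moreover have "inv_into (carrier K) f \<in> ring_iso (image_ring f K) K"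
    by (rule ring_iso_set_sym[OF K.ring_axioms inj_imp_image_ring_iso[OF f]])
  ultimately show ?thesis using has_coding_iso cring[OF L] K.cring_axioms by blast
qed

section \<open>The theorem of Los\<close>

lemma uclass_eq_iff:
  assumes "f \<in> uprep K" "g \<in> uprep K"
  shows "uclass U K f = uclass U K g \<longleftrightarrow> eventually (\<lambda>i. f i = g i) U"
proof
  assume "uclass U K f = uclass U K g"
  moreover have "g \<in> uclass U K g" using assms by (simp add: uclass_def)
  ultimately have "g \<in> uclass U K f" by (simp only:)
  then show "eventually (\<lambda>i. f i = g i) U" by (simp add: uclass_def)
next
  assume ev: "eventually (\<lambda>i. f i = g i) U"
  have "eventually (\<lambda>i. f i = h i) U \<longleftrightarrow> eventually (\<lambda>i. g i = h i) U" for h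
    by (rule eventually_cong[OF ev]) simp
  then show "uclass U K f = uclass U K g" by (simp add: uclass_def)
qed

lemma urep_uclass:
  assumes "f \<in> uprep K"
  shows "urep U K (uclass U K f) \<in> uprep K" "eventually (\<lambda>i. urep U K (uclass U K f) i = f i) U"
proof -
  have "urep U K (uclass U K f) \<in> uprep K \<and> uclass U K (urep U K (uclass U K f)) = uclass U K f"
    unfolding urep_def by (rule someI[of _ f]) (use assms in simp)
  then show "urep U K (uclass U K f) \<in> uprep K" "eventually (\<lambda>i. urep U K (uclass U K f) i = f i) U"
    using uclass_eq_iff[of "urep U K (uclass U K f)" K f U] assms by auto
qed

lemma uclass_in_uset_iff:
  assumes "f \<in> uprep K"
  shows "uclass U K f \<in> uset U K A \<longleftrightarrow> eventually (\<lambda>i. f i \<in> A i) U"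
proof
  assume "uclass U K f \<in> uset U K A"
  then obtain g where g: "g \<in> uprep K" "eventually (\<lambda>i. g i \<in> A i) U" "uclass U K f = uclass U K g"
    by (auto simp: uset_def)
  have "eventually (\<lambda>i. f i = g i) U" using g assms by (simp add: uclass_eq_iff)
  with g(2) show "eventually (\<lambda>i. f i \<in> A i) U" by eventually_elim simp
next
  assume "eventually (\<lambda>i. f i \<in> A i) U"
  then show "uclass U K f \<in> uset U K A" using assms by (auto simp: uset_def)
qed

lemma uset_subset_ucarrier: "uset U K A \<subseteq> ucarrier U K"
  by (auto simp: uset_def ucarrier_def)

text \<open>The operations of the ultraproduct act on the representatives chosen by
  \<open>urep\<close>, which agree with the given ones only on a set in U; this is enough for
  equality of classes.\<close>

lemma ueval_uclass:
  assumes ring: "\<And>i. ring (K i)" and r: "\<And>n. r n \<in> uprep K"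
  shows "ueval U K (\<lambda>n. uclass U K (r n)) t = uclass U K (\<lambda>i. reval (K i) (\<lambda>n. r n i) t)"
proof (induction t)
  have closed: "(\<lambda>i. reval (K i) (\<lambda>n. r n i) t) \<in> uprep K" for t
    using r reval_closed[OF ring] by (simp add: uprep_def)
  note rep = urep_uclass[OF closed]
  note rep_closed = rep(1)[unfolded uprep_def mem_Collect_eq, rule_format]
  {
    case (Add s t)
    have "(\<lambda>i. urep U K (uclass U K (\<lambda>i. reval (K i) (\<lambda>n. r n i) s)) i \<oplus>\<^bsub>K i\<^esub>
        urep U K (uclass U K (\<lambda>i. reval (K i) (\<lambda>n. r n i) t)) i) \<in> uprep K"
      by (simp add: uprep_def ring.ring_simprules(1)[OF ring] rep_closed)
    moreover have "eventually (\<lambda>i. urep U K (uclass U K (\<lambda>i. reval (K i) (\<lambda>n. r n i) s)) i \<oplus>\<^bsub>K i\<^esub>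
        urep U K (uclass U K (\<lambda>i. reval (K i) (\<lambda>n. r n i) t)) i = reval (K i) (\<lambda>n. r n i) (Add s t)) U"
      using rep(2)[of U s] rep(2)[of U t] by eventually_elim simp
    ultimately show ?case
      using closed[of "Add s t"] by (simp add: Add.IH uadd_def uclass_eq_iff)
  next
    case (Mul s t)
    have "(\<lambda>i. urep U K (uclass U K (\<lambda>i. reval (K i) (\<lambda>n. r n i) s)) i \<otimes>\<^bsub>K i\<^esub>
        urep U K (uclass U K (\<lambda>i. reval (K i) (\<lambda>n. r n i) t)) i) \<in> uprep K"
      by (simp add: uprep_def ring.ring_simprules(5)[OF ring] rep_closed)
    moreover have "eventually (\<lambda>i. urep U K (uclass U K (\<lambda>i. reval (K i) (\<lambda>n. r n i) s)) i \<otimes>\<^bsub>K i\<^esub>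
        urep U K (uclass U K (\<lambda>i. reval (K i) (\<lambda>n. r n i) t)) i = reval (K i) (\<lambda>n. r n i) (Mul s t)) U"
      using rep(2)[of U s] rep(2)[of U t] by eventually_elim simp
    ultimately show ?case
      using closed[of "Mul s t"] by (simp add: Mul.IH umul_def uclass_eq_iff)
  next
    case (Neg s)
    have "(\<lambda>i. \<ominus>\<^bsub>K i\<^esub> urep U K (uclass U K (\<lambda>i. reval (K i) (\<lambda>n. r n i) s)) i) \<in> uprep K"
      by (simp add: uprep_def ring.ring_simprules(3)[OF ring] rep_closed)
    moreover have "eventually (\<lambda>i. \<ominus>\<^bsub>K i\<^esub> urep U K (uclass U K (\<lambda>i. reval (K i) (\<lambda>n. r n i) s)) i
        = reval (K i) (\<lambda>n. r n i) (Neg s)) U"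
      using rep(2)[of U s] by eventually_elim simp
    ultimately show ?case
      using closed[of "Neg s"] by (simp add: Neg.IH uneg_def uclass_eq_iff)
  }
qed (simp_all add: uzero_def uone_def)

lemma ultrafilter_eventually_not_iff:
  assumes "ultrafilter U"
  shows "eventually (\<lambda>i. \<not> P i) U \<longleftrightarrow> \<not> eventually P U"
proof -
  have "\<not> (eventually P U \<and> eventually (\<lambda>i. \<not> P i) U)"
  proof
    assume "eventually P U \<and> eventually (\<lambda>i. \<not> P i) U"
    then have "eventually (\<lambda>_. False) U" by (auto elim: eventually_elim2)
    then show False using assms by (simp add: ultrafilter_def eventually_False)
  qed
  then show ?thesis using assms unfolding ultrafilter_def by blast
qed

lemma usat_iff_eventually_rsat:
  fixes K :: "'i \<Rightarrow> ('a, 'b) ring_scheme"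
  assumes U: "ultrafilter U" and ring: "\<And>i. ring (K i)" and r: "\<And>n. r n \<in> uprep K"
  shows "usat U K (uset U K A) (\<lambda>n. uclass U K (r n)) \<phi> \<longleftrightarrow>
    eventually (\<lambda>i. rsat (K i) (A i) (\<lambda>n. r n i) \<phi>) U"
  using r
proof (induction \<phi> arbitrary: r)
  case (Eq s t)
  have "(\<lambda>i. reval (K i) (\<lambda>n. r n i) t) \<in> uprep K" for t
    using Eq reval_closed[OF ring] by (simp add: uprep_def)
  then show ?case using Eq by (simp add: ueval_uclass[OF ring] uclass_eq_iff)
next
  case (Pred t)
  have "(\<lambda>i. reval (K i) (\<lambda>n. r n i) t) \<in> uprep K"
    using Pred reval_closed[OF ring] by (simp add: uprep_def)
  then show ?case using Pred by (simp add: ueval_uclass[OF ring] uclass_in_uset_iff)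
next
  case (Not \<phi>)
  then show ?case by (simp add: ultrafilter_eventually_not_iff[OF U])
next
  case (Conj \<phi> \<psi>)
  then show ?case by (simp add: eventually_conj_iff)
next
  case (Ex n \<phi>)
  have step: "usat U K (uset U K A) ((\<lambda>k. uclass U K (r k))(n := uclass U K f)) \<phi> \<longleftrightarrow>
      eventually (\<lambda>i. rsat (K i) (A i) ((\<lambda>k. r k i)(n := f i)) \<phi>) U" if f: "f \<in> uprep K" for f
  proof -
    have "(\<lambda>k. uclass U K ((r(n := f)) k)) = (\<lambda>k. uclass U K (r k))(n := uclass U K f)"
      by (simp add: fun_eq_iff)
    moreover have "(\<lambda>k. (r(n := f)) k i) = (\<lambda>k. r k i)(n := f i)" for i
      by (simp add: fun_eq_iff)
    moreover have "(r(n := f)) k \<in> uprep K" for k using Ex.prems f by simp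
    ultimately show ?thesis using Ex.IH[of "r(n := f)"] by (simp only:)
  qed
  have "usat U K (uset U K A) (\<lambda>k. uclass U K (r k)) (Ex n \<phi>) \<longleftrightarrow>
      (\<exists>f\<in>uprep K. eventually (\<lambda>i. rsat (K i) (A i) ((\<lambda>k. r k i)(n := f i)) \<phi>) U)"
    by (simp add: ucarrier_def step cong: bex_cong)
  also have "\<dots> \<longleftrightarrow> eventually (\<lambda>i. rsat (K i) (A i) (\<lambda>k. r k i) (Ex n \<phi>)) U"
  proof
    assume "\<exists>f\<in>uprep K. eventually (\<lambda>i. rsat (K i) (A i) ((\<lambda>k. r k i)(n := f i)) \<phi>) U"
    then obtain f where f: "\<And>i. f i \<in> carrier (K i)"
      "eventually (\<lambda>i. rsat (K i) (A i) ((\<lambda>k. r k i)(n := f i)) \<phi>) U" by (auto simp: uprep_def)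
    from f(2) show "eventually (\<lambda>i. rsat (K i) (A i) (\<lambda>k. r k i) (Ex n \<phi>)) U"
      by eventually_elim (use f(1) in auto)
  next
    assume ev: "eventually (\<lambda>i. rsat (K i) (A i) (\<lambda>k. r k i) (Ex n \<phi>)) U"
    \<comment> \<open>The witness function must take values in the carrier at every index. Where no
      witness exists, \<open>r n i\<close> is the default.\<close>
    have "\<exists>a. a \<in> carrier (K i) \<and> (rsat (K i) (A i) (\<lambda>k. r k i) (Ex n \<phi>) \<longrightarrow>
        rsat (K i) (A i) ((\<lambda>k. r k i)(n := a)) \<phi>)" for i
      using Ex.prems[of n] by (auto simp: uprep_def)
    then obtain f where f: "\<And>i. f i \<in> carrier (K i)"
      "\<And>i. rsat (K i) (A i) (\<lambda>k. r k i) (Ex n \<phi>) \<Longrightarrow> rsat (K i) (A i) ((\<lambda>k. r k i)(n := f i)) \<phi>"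
      by metis
    from ev have "eventually (\<lambda>i. rsat (K i) (A i) ((\<lambda>k. r k i)(n := f i)) \<phi>) U"
      by eventually_elim (rule f(2))
    then show "\<exists>f\<in>uprep K. eventually (\<lambda>i. rsat (K i) (A i) ((\<lambda>k. r k i)(n := f i)) \<phi>) U"
      using f(1) by (auto simp: uprep_def)
  qed
  finally show ?case .
qed

section \<open>Large fields\<close>

lemma ultrafilter_eventually_bex:
  assumes U: "ultrafilter U" and fin: "finite J" and ev: "eventually (\<lambda>i. \<exists>j\<in>J. P j i) U"
  shows "\<exists>j\<in>J. eventually (P j) U"
proof (rule ccontr)
  assume "\<not> ?thesis"
  then have "\<forall>j\<in>J. eventually (\<lambda>i. \<not> P j i) U"
    using ultrafilter_eventually_not_iff[OF U] by blast
  then have "eventually (\<lambda>i. \<forall>j\<in>J. \<not> P j i) U" by (rule eventually_ball_finite[OF fin])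
  then have "eventually (\<lambda>i. \<not> (\<exists>j\<in>J. P j i)) U" by (rule eventually_mono) blast
  then show False using ev ultrafilter_eventually_not_iff[OF U] by blast
qed

text \<open>After enumerating every A_i, an element of the ultraproduct has at most k possible
  positions on a set in U, and the ultrafilter selects one of them. Contrapositively, an infinite A
  forces |A_i| above every bound.\<close>

lemma finite_uset_of_bounded_card:
  assumes U: "ultrafilter U" and A: "\<And>i. A i \<subseteq> carrier (K i)" "\<And>i. finite (A i)"
    and bound: "eventually (\<lambda>i. card (A i) \<le> k) U" and ring: "\<And>i. ring (K i)"
  shows "finite (uset U K A)"
proof -
  obtain h where h: "\<And>i. bij_betw (h i) {0..<card (A i)} (A i)"
    using ex_bij_betw_nat_finite[OF A(2)] by metis
  have e: "\<exists>j<card (A i). x = h i j" if "x \<in> A i" for i x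
  proof -
    have "x \<in> h i ` {0..<card (A i)}" using h[of i] that by (simp add: bij_betw_def)
    then show ?thesis by auto
  qed
  \<comment> \<open>\<open>h i j\<close> is controlled only for j below \<open>card (A i)\<close>;
    the default zero keeps \<open>g j\<close> in \<open>uprep K\<close>.\<close>
  define g where "g j i = (if h i j \<in> carrier (K i) then h i j else \<zero>\<^bsub>K i\<^esub>)" for j i
  have g: "g j \<in> uprep K" for j
    using ring.ring_simprules(2)[OF ring] by (simp add: g_def uprep_def)
  have "uset U K A \<subseteq> (\<lambda>j. uclass U K (g j)) ` {..<k}"
  proof
    fix x assume "x \<in> uset U K A"
    then obtain f where f: "f \<in> uprep K" "eventually (\<lambda>i. f i \<in> A i) U" "x = uclass U K f"
      by (auto simp: uset_def)
    have "eventually (\<lambda>i. \<exists>j\<in>{..<k}. f i = g j i) U"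
      using f(2) bound
    proof eventually_elim
      case (elim i)
      obtain j where "j < card (A i)" "f i = h i j" using e[OF elim(1)] by blast
      then show ?case using elim A(1)[of i] by (auto simp: g_def intro!: bexI[of _ j])
    qed
    then obtain j where "j < k" "eventually (\<lambda>i. f i = g j i) U"
      using ultrafilter_eventually_bex[OF U, of "{..<k}" "\<lambda>j i. f i = g j i"] by auto
    then show "x \<in> (\<lambda>j. uclass U K (g j)) ` {..<k}"
      using uclass_eq_iff[OF f(1) g] f(3) by auto
  qed
  then show ?thesis by (rule finite_subset) simp
qed

text \<open>Take k near q^(3/8). The exponent is below 1/2, as 12 n k^2 < q demands for n of order
  log q, and above 1/4, so that 4n q^(1/4) < k. With m > 4C one has 2^n \<le> q^C \<le> (q^(1/4))^m,
  and the m-th power of 4n q^(1/4) < k finishes.\<close>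

lemma eventually_large_field:
  fixes C :: real
  assumes "C > 0"
  shows "\<exists>m. \<forall>\<^sub>F q in sequentially. \<forall>n. real n \<le> C * log 2 (real q) \<longrightarrow> large_field m n q"
proof -
  define m where "m = nat \<lceil>4 * C\<rceil> + 1"
  have m: "m > 0" "real m > 4 * C" unfolding m_def using assms by linarith+
  have "\<forall>\<^sub>F x::real in at_top. 12 * (C * log 2 x) * (x powr (3 / 8))\<^sup>2 < x \<and>
      4 * (C * log 2 x) * x powr (1 / 4) < x powr (3 / 8) - 1 \<and> x > 1 \<and> x powr (3 / 8) > 1"
    using assms by (intro eventually_conj; real_asymp)
  then have "\<forall>\<^sub>F q in sequentially. 12 * (C * log 2 (real q)) * (real q powr (3 / 8))\<^sup>2 < real q \<and>
      4 * (C * log 2 (real q)) * real q powr (1 / 4) < real q powr (3 / 8) - 1 \<and> real q > 1 \<and>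
      real q powr (3 / 8) > 1"
    by (rule eventually_compose_filterlim[OF _ filterlim_real_sequentially])
  then have "\<forall>\<^sub>F q in sequentially. \<forall>n. real n \<le> C * log 2 (real q) \<longrightarrow> large_field m n q"
  proof eventually_elim
    case (elim q)
    show ?case
    proof (intro allI impI)
      fix n :: nat assume n: "real n \<le> C * log 2 (real q)"
      define k where "k = nat \<lfloor>real q powr (3 / 8)\<rfloor>"
      have k: "real k \<le> real q powr (3 / 8)" "real q powr (3 / 8) - 1 < real k"
        unfolding k_def using elim by linarith+
      then have k0: "k > 0" using elim by (cases k) auto
      have "real (12 * n * k\<^sup>2) \<le> 12 * (C * log 2 (real q)) * (real q powr (3 / 8))\<^sup>2"
      proof -
        have "12 * real n * (real k)\<^sup>2 \<le> 12 * (C * log 2 (real q)) * (real q powr (3 / 8))\<^sup>2"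
          using n k by (intro mult_mono power_mono) auto
        then show ?thesis by simp
      qed
      then have "real (12 * n * k\<^sup>2) < real q" using elim by linarith
      then have 1: "12 * n * k\<^sup>2 < q" by (simp only: of_nat_less_iff)
      have "4 * real n * real q powr (1 / 4) < real k"
      proof -
        have "4 * real n * real q powr (1 / 4) \<le> 4 * (C * log 2 (real q)) * real q powr (1 / 4)"
          using n by (intro mult_right_mono) auto
        then show ?thesis using elim k by linarith
      qed
      then have "(4 * real n * real q powr (1 / 4)) ^ m < real k ^ m"
        using m(1) by (intro power_strict_mono) auto
      then have pow: "(4 * real n) ^ m * (real q powr (1 / 4)) ^ m < real k ^ m"
        by (simp only: power_mult_distrib)
      have "2 ^ n = 2 powr real n" by (simp add: powr_realpow)
      also have "\<dots> \<le> 2 powr (C * log 2 (real q))" using n by (intro powr_mono) auto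
      also have "\<dots> = real q powr C"
        using elim by (simp add: powr_powr[symmetric] mult.commute[of C])
      also have "\<dots> \<le> real q powr (1 / 4 * real m)" using m(2) elim by (intro powr_mono) auto
      also have "\<dots> = (real q powr (1 / 4)) powr real m" by (simp add: powr_powr)
      also have "\<dots> = (real q powr (1 / 4)) ^ m" using elim by (intro powr_realpow) simp
      finally have "2 ^ n * (4 * real n) ^ m \<le> (real q powr (1 / 4)) ^ m * (4 * real n) ^ m"
        by (intro mult_right_mono) auto
      then have "2 ^ n * (4 * real n) ^ m < real k ^ m" using pow by (simp only: mult.commute)
      then have "real (2 ^ n * (4 * n) ^ m) < real (k ^ m)" by simp
      then have "2 ^ n * (4 * n) ^ m < k ^ m" by (simp only: of_nat_less_iff)
      then show "large_field m n q" unfolding large_field_def using k0 1 by blast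
    qed
  qed
  then show ?thesis by blast
qed

theorem theorem4p3:
  fixes U :: "'i filter" and K :: "'i \<Rightarrow> ('a, 'b) ring_scheme" and A :: "'i \<Rightarrow> 'a set"
  assumes "ultrafilter U" and "nonprincipal U"
    and "\<And>i. field (K i)" and "\<And>i. finite (carrier (K i))"
    and "\<And>i. A i \<subseteq> carrier (K i)"
    and "infinite (uset U K A)"
    and "\<exists>C>0. eventually (\<lambda>i. real (card (A i)) \<le> C * log 2 (real (card (carrier (K i))))) U"
  shows "\<exists>\<theta>::rfm. \<forall>E. internal U K E \<and> E \<subseteq> uset U K A \<longrightarrow>
           (\<exists>c. (\<forall>k. c k \<in> ucarrier U K) \<and>
                E = {a \<in> ucarrier U K. usat U K (uset U K A) (case_nat a c) \<theta>})"
proof -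
  note U = assms(1) and fin = assms(4) and A = assms(5)
  have ring: "ring (K i)" for i
    using assms(3)[of i] by (meson cring.axioms(1) domain.axioms(1) field.axioms(1))
  have finA: "finite (A i)" for i using A fin by (rule finite_subset)
  obtain C where C: "C > 0"
    "eventually (\<lambda>i. real (card (A i)) \<le> C * log 2 (real (card (carrier (K i))))) U"
    using assms(7) by blast
  obtain m q0 where m: "\<And>q n. q \<ge> q0 \<Longrightarrow> real n \<le> C * log 2 (real q) \<Longrightarrow> large_field m n q"
    using eventually_large_field[OF C(1)] unfolding eventually_sequentially by blast
  \<comment> \<open>Infinitude of A makes |A_i|, and with it q_i, exceed the threshold q0 on a set
    in U.\<close>
  have "\<not> eventually (\<lambda>i. card (A i) \<le> q0) U"
    using finite_uset_of_bounded_card[where K = K and A = A and k = q0, OF U A finA _ ring] assms(6)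
    by blast
  then have "eventually (\<lambda>i. \<not> card (A i) \<le> q0) U"
    using ultrafilter_eventually_not_iff[OF U] by blast
  with C(2) have large: "eventually (\<lambda>i. large_field m (card (A i)) (card (carrier (K i)))) U"
  proof eventually_elim
    case (elim i)
    have "card (A i) \<le> card (carrier (K i))" by (rule card_mono[OF fin A])
    then show ?case using elim by (intro m) auto
  qed
  \<comment> \<open>The formula must be the same for all i, so the ultrafilter decides once whether
    2 = 0.\<close>
  define char2 where "char2 \<longleftrightarrow> eventually (\<lambda>i. \<one>\<^bsub>K i\<^esub> \<oplus>\<^bsub>K i\<^esub> \<one>\<^bsub>K i\<^esub> = \<zero>\<^bsub>K i\<^esub>) U"
  have "eventually (\<lambda>i. (\<one>\<^bsub>K i\<^esub> \<oplus>\<^bsub>K i\<^esub> \<one>\<^bsub>K i\<^esub> = \<zero>\<^bsub>K i\<^esub>) = char2) U"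
  proof (cases char2)
    case True
    then show ?thesis by (simp add: char2_def)
  next
    case False
    then show ?thesis using ultrafilter_eventually_not_iff[OF U] by (simp add: char2_def)
  qed
  with large have codes: "eventually (\<lambda>i. codes_subsets (K i) (A i) (coding_fm char2 m)) U"
  proof eventually_elim
    case (elim i)
    have "has_coding (K i)" by (rule has_coding_finite_field[OF assms(3) fin])
    then have "codes_subsets (K i) (A i) (coding_fm (\<one>\<^bsub>K i\<^esub> \<oplus>\<^bsub>K i\<^esub> \<one>\<^bsub>K i\<^esub> = \<zero>\<^bsub>K i\<^esub>) m)"
      using A[of i] elim(1) unfolding has_coding_def by blast
    then show ?case unfolding elim(2) .
  qed
  \<comment> \<open>The conjunct for A is essential: outside A the coding formula is
    uncontrolled.\<close>
  define \<theta> where "\<theta> = Conj (Pred (Var 0)) (coding_fm char2 m)"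
  have "\<exists>c. (\<forall>k. c k \<in> ucarrier U K) \<and>
      E = {a \<in> ucarrier U K. usat U K (uset U K A) (case_nat a c) \<theta>}"
    if E: "internal U K E" "E \<subseteq> uset U K A" for E
  proof -
    obtain E' where E': "E = uset U K E'" using E(1) by (auto simp: internal_def)
    \<comment> \<open>The inclusion of E in A does not give \<open>E' i \<subseteq> A i\<close> at
      every index, so the intersection is coded. Where coding fails, zero parameters keep c inside
      the carrier.\<close>
    have "\<exists>c. (\<forall>k. c k \<in> carrier (K i)) \<and> (codes_subsets (K i) (A i) (coding_fm char2 m) \<longrightarrow>
        (\<forall>x\<in>A i. rsat (K i) (A i) (case_nat x c) (coding_fm char2 m) \<longleftrightarrow> x \<in> E' i \<inter> A i))" for i
    proof (cases "codes_subsets (K i) (A i) (coding_fm char2 m)")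
      case True
      then show ?thesis unfolding codes_subsets_def by (meson Int_lower2)
    next
      case False
      then show ?thesis
        using ring.ring_simprules(2)[OF ring] by (intro exI[of _ "\<lambda>_. \<zero>\<^bsub>K i\<^esub>"]) simp
    qed
    then obtain c where c: "\<And>i k. c i k \<in> carrier (K i)"
      "\<And>i x. codes_subsets (K i) (A i) (coding_fm char2 m) \<Longrightarrow> x \<in> A i \<Longrightarrow>
         rsat (K i) (A i) (case_nat x (c i)) (coding_fm char2 m) \<longleftrightarrow> x \<in> E' i \<inter> A i"
      by metis
    have cprep: "(\<lambda>i. c i k) \<in> uprep K" for k using c(1) by (simp add: uprep_def)
    have "usat U K (uset U K A) (case_nat (uclass U K f) (\<lambda>k. uclass U K (\<lambda>i. c i k))) \<theta> \<longleftrightarrow>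
        uclass U K f \<in> E" if f: "f \<in> uprep K" for f
    proof -
      have "case_nat (uclass U K f) (\<lambda>k. uclass U K (\<lambda>i. c i k)) =
          (\<lambda>n. uclass U K (case_nat f (\<lambda>k i. c i k) n))"
        by (simp add: fun_eq_iff split: nat.split)
      moreover have "case_nat f (\<lambda>k i. c i k) n \<in> uprep K" for n
        using f cprep by (simp split: nat.split)
      moreover have "(\<lambda>n. case_nat f (\<lambda>k i. c i k) n i) = case_nat (f i) (c i)" for i
        by (simp add: fun_eq_iff split: nat.split)
      ultimately have "usat U K (uset U K A) (case_nat (uclass U K f) (\<lambda>k. uclass U K (\<lambda>i. c i k))) \<theta> \<longleftrightarrow>
          eventually (\<lambda>i. rsat (K i) (A i) (case_nat (f i) (c i)) \<theta>) U"
        using usat_iff_eventually_rsat[where r = "case_nat f (\<lambda>k i. c i k)" and A = A and \<phi> = \<theta>, OF U ring]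
        by simp
      also have "\<dots> \<longleftrightarrow> eventually (\<lambda>i. f i \<in> E' i \<and> f i \<in> A i) U"
        using codes by (rule eventually_cong) (auto simp: \<theta>_def c(2))
      also have "\<dots> \<longleftrightarrow> uclass U K f \<in> E \<and> uclass U K f \<in> uset U K A"
        using f by (simp add: E' uclass_in_uset_iff eventually_conj_iff)
      finally show ?thesis using E(2) by blast
    qed
    moreover have "E \<subseteq> ucarrier U K" unfolding E' by (rule uset_subset_ucarrier)
    ultimately have "E = {a \<in> ucarrier U K.
        usat U K (uset U K A) (case_nat a (\<lambda>k. uclass U K (\<lambda>i. c i k))) \<theta>}"
      unfolding ucarrier_def by auto
    moreover have "uclass U K (\<lambda>i. c i k) \<in> ucarrier U K" for k
      using cprep by (simp add: ucarrier_def)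
    ultimately show ?thesis
      by (intro exI[of _ "\<lambda>k. uclass U K (\<lambda>i. c i k)"] conjI allI)
  qed
  then show ?thesis by blast
qed

end
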